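(* For $\Delta>1$ let $\ell_*(\Delta)$ be the infimum of $\ell$ over all SIRSNs with $\mathbb E D_1=\Delta$. Then $\ell_*(\Delta)=\Omega((\Delta-1)^{-1/2})$ as $\Delta\downarrow1$; that is, there exist constants $c>0$ and $\delta>0$ such that $\ell_*(\Delta)\ge c(\Delta-1)^{-1/2}$ for all $1<\Delta<1+\delta$.
   Context: $\mathbf 0$ is the origin of $\mathbb{R}^2$, $\mathbf 1=(1,0)$, $\mathrm{disc}(z,r)$ is the closed disc, $\mathrm{len}$ is length, $\sigma_c(z)=cz$. A (feasible) route $\mathsf r(z,z')$ is a non-self-intersecting path from $z$ to $z'$ made of straight line segments between successive points $(z_i)$, with finite, semi-infinite or doubly infinite index set (with $z_i\to z$ as $i\to-\infty$, $z_i\to z'$ as $i\to\infty$ in the infinite directions), of finite total length; $\mathsf r(z',z)$ is the reversal of $\mathsf r(z,z')$. Routes are pairwise compatible if whenever two routes meet at two points they coincide on the subroute between these points. A feasible subnetwork on a locally finite configuration $(z_i)$ is the union $\mathsf s$ of pairwise compatible routes $\mathsf r(z_i,z_j)$, one for each pair (with marks recording which edges are in which routes), with $\mathrm{len}(\mathsf s\cap \mathrm{disc}(\mathbf 0,r))<\infty$ for all $r<\infty$. A process of random routes $\mathcal R(z_1,z_2)$, $z_1,z_2\in\mathbb R^2$, is specified by its finite-dimensional distributions: for each finite set $z_1,\dots,z_k$, the distribution $\mu_{z_1,\dots,z_k}$ of the random feasible subnetwork $\mathrm{span}(z_1,\dots,z_k)$ formed by the routes $\mathcal R(z_i,z_j)$.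 These are required to be consistent, invariant under translation and rotation, invariant under scaling (the image of $\mathrm{span}(z_1,\dots,z_k)$ under $\sigma_c$ is distributed as $\mathrm{span}(cz_1,\dots,cz_k)$, for all $c>0$), and with $(z_1,\dots,z_k)\mapsto\mu_{z_1,\dots,z_k}$ measurable. Let $(\Xi(\lambda),0<\lambda<\infty)$ be the positions of the points arriving during time $[0,\lambda]$ in a rate-one space-time Poisson point process on $\mathbb R^2\times[0,\infty)$, independent of the routes, and let $\mathcal S(\lambda)$ be the subnetwork on $\Xi(\lambda)$ consisting of the routes $\mathcal R(\xi,\xi')$, $\xi,\xi'\in\Xi(\lambda)$. The edge-intensity of a translation-invariant random edge process $\mathcal E$ is the $\iota\in[0,\infty]$ with $\mathbb E\,\mathrm{len}(\mathcal E\cap A)=\iota\cdot\mathrm{area}(A)$. Put $D_1=\mathrm{len}\,\mathcal R(\mathbf 0,\mathbf 1)$, $\ell=$ edge-intensity of $\mathcal S(1)$, $\mathcal E(\lambda,r)=\bigcup_{\xi,\xi'\in\Xi(\lambda)}\mathcal R(\xi,\xi')\setminus(\mathrm{disc}(\xi,r)\cup\mathrm{disc}(\xi',r))$, $p(\lambda,r)=$ edge-intensity of $\mathcal E(\lambda,r)$, $p(r)=\lim_{\lambda\to\infty}p(\lambda,r)$. The process is a SIRSN if its finite-dimensional distributions are distributions of random feasible subnetworks which are consistent, invariant under translation, rotation and scaling, and depend measurably on $(z_1,\dots,z_k)$, and moreover $1<\mathbb E D_1<\infty$ and $p(1)<\infty$ (this implies $\ell<\infty$). The infimum over an empty set is $+\infty$.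 *)

theory Defs
  imports "HOL-Probability.Probability"
begin

text \<open>
  The plane is \<^typ>\<open>complex\<close>: the origin is 0, the point (1,0) is 1, rotations are
  multiplications by \<^term>\<open>cis \<theta>\<close> and scalings are multiplications by positive reals.
\<close>

section \<open>Length, routes and networks\<close>

text \<open>Length of a planar set is its one-dimensional Hausdorff measure.\<close>

definition len :: "complex set \<Rightarrow> ennreal" where
  "len S = (SUP d\<in>{0::real<..}.
     INF U\<in>{U :: nat \<Rightarrow> complex set. S \<subseteq> (\<Union>i. U i) \<and> (\<forall>i. bounded (U i) \<and> diameter (U i) \<le> d)}.
       (\<Sum>i. ennreal (diameter (U i))))"

text \<open>
  A non-self-intersecting path is determined, up to parametrisation, by its end points and its
  image, so a route is stored as its image; a route and its reversal are the same set.
  The vertices are \<^term>\<open>g (t i)\<close> for \<open>i\<close> in an interval \<open>I\<close> of integers, which may be finite,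
  semi-infinite or doubly infinite. As the parameter intervals of the edges cover the
  open unit interval, the vertices start at (or tend to) \<open>z\<close> and end at (or tend to) \<open>z'\<close>.
\<close>

definition route :: "complex \<Rightarrow> complex \<Rightarrow> complex set \<Rightarrow> bool" where
  "route z z' r \<longleftrightarrow>
     (\<exists>g (I :: int set) (t :: int \<Rightarrow> real).
        arc g \<and> pathstart g = z \<and> pathfinish g = z' \<and> path_image g = r \<and>
        (\<forall>i\<in>I. \<forall>j\<in>I. {i..j} \<subseteq> I) \<and>
        t ` I \<subseteq> {0..1} \<and> strict_mono_on I t \<and>
        {0<..<1} \<subseteq> (\<Union>i\<in>{i\<in>I. i + 1 \<in> I}. {t i..t (i + 1)}) \<and>
        (\<forall>i\<in>I. i + 1 \<in> I \<longrightarrow>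
           g ` {t i..t (i + 1)} = closed_segment (g (t i)) (g (t (i + 1))))) \<and>
     len r < \<infinity>"

text \<open>Inside a non-self-intersecting path \<open>r\<close> the set \<open>s\<close> is determined by its end points.\<close>

definition subroute :: "complex set \<Rightarrow> complex \<Rightarrow> complex \<Rightarrow> complex set \<Rightarrow> bool" where
  "subroute r x y s \<longleftrightarrow>
     s \<subseteq> r \<and> (\<exists>h. arc h \<and> pathstart h = x \<and> pathfinish h = y \<and> path_image h = s)"

definition compatible :: "complex set \<Rightarrow> complex set \<Rightarrow> bool" where
  "compatible r r' \<longleftrightarrow>
     (\<forall>x\<in>r \<inter> r'. \<forall>y\<in>r \<inter> r'. \<forall>s s'. subroute r x y s \<and> subroute r' x y s' \<longrightarrow> s = s')"

definition pairs :: "nat set \<Rightarrow> (nat \<times> nat) set" where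
  "pairs I = {(i, j). i \<in> I \<and> j \<in> I \<and> i \<noteq> j}"

text \<open>
  A network on the points \<open>z i\<close> maps the pair \<open>(i, j)\<close> to the route from \<open>z i\<close> to \<open>z j\<close>;
  this records the union of the routes together with the marks.
\<close>

type_synonym network = "nat \<times> nat \<Rightarrow> complex set"

definition feasible :: "nat set \<Rightarrow> (nat \<Rightarrow> complex) \<Rightarrow> network \<Rightarrow> bool" where
  "feasible I z N \<longleftrightarrow>
     N \<in> extensional (pairs I) \<and>
     (\<forall>(i, j)\<in>pairs I. route (z i) (z j) (N (i, j)) \<and> N (j, i) = N (i, j)) \<and>
     (\<forall>p\<in>pairs I. \<forall>q\<in>pairs I. compatible (N p) (N q)) \<and>
     (\<forall>r. len ((\<Union>p\<in>pairs I. N p) \<inter> cball 0 r) < \<infinity>)"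

text \<open>
  The measurable space of feasible networks on \<open>k\<close> distinct points. The sigma-algebra is that of
  marked length measures: it is generated by the lengths, within Borel sets \<open>B\<close>, of the part of
  the network whose marks include all the pairs in \<open>F\<close>. These lengths determine each route, as a
  route is the support of its length measure.
\<close>

definition network_space :: "nat \<Rightarrow> network measure" where
  "network_space k =
     (let X = {N. \<exists>z. inj_on z {..<k} \<and> feasible {..<k} z N} in
      sigma X {{N\<in>X. len (B \<inter> (\<Inter>p\<in>F. N p)) \<le> a} | B F a.
                 B \<in> sets borel \<and> F \<subseteq> pairs {..<k} \<and> F \<noteq> {}})"

section \<open>Processes of random routes\<close>

text \<open>
  \<^term>\<open>\<mu> k z\<close> is the distribution of the network spanned by the \<open>k\<close> distinct points
  \<open>z 0, \<dots>, z (k - 1)\<close>.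
\<close>

type_synonym fdds = "nat \<Rightarrow> (nat \<Rightarrow> complex) \<Rightarrow> network measure"

definition configurations :: "nat \<Rightarrow> (nat \<Rightarrow> complex) measure" where
  "configurations k = restrict_space (PiM {..<k} (\<lambda>_. borel)) {z. inj_on z {..<k}}"

definition measurable_fdds :: "fdds \<Rightarrow> bool" where
  "measurable_fdds \<mu> \<longleftrightarrow>
     (\<forall>k. \<mu> k \<in> measurable (configurations k) (prob_algebra (network_space k)))"

definition feasible_fdds :: "fdds \<Rightarrow> bool" where
  "feasible_fdds \<mu> \<longleftrightarrow>
     (\<forall>k. \<forall>z\<in>space (configurations k). AE N in \<mu> k z. feasible {..<k} z N)"

text \<open>The injections \<open>f\<close> cover both passing to a subset of the points and reordering them.\<close>

definition consistent :: "fdds \<Rightarrow> bool" where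
  "consistent \<mu> \<longleftrightarrow>
     (\<forall>k m f. \<forall>z\<in>space (configurations k). inj_on f {..<m} \<and> f ` {..<m} \<subseteq> {..<k} \<longrightarrow>
        distr (\<mu> k z) (network_space m) (\<lambda>N. \<lambda>(i, j)\<in>pairs {..<m}. N (f i, f j))
          = \<mu> m (\<lambda>i\<in>{..<m}. z (f i)))"

definition invariant_under :: "(complex \<Rightarrow> complex) \<Rightarrow> fdds \<Rightarrow> bool" where
  "invariant_under T \<mu> \<longleftrightarrow>
     (\<forall>k. \<forall>z\<in>space (configurations k).
        distr (\<mu> k z) (network_space k) (\<lambda>N. \<lambda>p\<in>pairs {..<k}. T ` N p)
          = \<mu> k (\<lambda>i\<in>{..<k}. T (z i)))"

definition scale_invariant_fdds :: "fdds \<Rightarrow> bool" where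
  "scale_invariant_fdds \<mu> \<longleftrightarrow>
     measurable_fdds \<mu> \<and> feasible_fdds \<mu> \<and> consistent \<mu> \<and>
     (\<forall>b. invariant_under (\<lambda>x. b + x) \<mu>) \<and>
     (\<forall>\<theta>. invariant_under (\<lambda>x. cis \<theta> * x) \<mu>) \<and>
     (\<forall>c>0. invariant_under (\<lambda>x. complex_of_real c * x) \<mu>)"

definition expected_D1 :: "fdds \<Rightarrow> ennreal" where
  "expected_D1 \<mu> = (\<integral>\<^sup>+ N. len (N (0, 1)) \<partial>(\<mu> 2 (\<lambda>i\<in>{..<2}. if i = 0 then 0 else 1)))"

section \<open>Sampling at Poisson points\<close>

text \<open>
  An outcome consists of an enumeration of the space-time points (position, arrival time) and, for
  each pair of indices, of the route between the positions. Nothing is lost by working on this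
  canonical sample space, since only the joint law matters.
\<close>

type_synonym outcome = "(nat \<Rightarrow> complex \<times> real) \<times> network"

definition position :: "outcome \<Rightarrow> nat \<Rightarrow> complex" where
  "position \<omega> i = fst (fst \<omega> i)"

definition arrival :: "outcome \<Rightarrow> nat \<Rightarrow> real" where
  "arrival \<omega> i = snd (fst \<omega> i)"

definition count_in :: "(complex \<times> real) set \<Rightarrow> outcome \<Rightarrow> ennreal" where
  "count_in B \<omega> = emeasure (count_space UNIV) {i. fst \<omega> i \<in> B}"

definition finite_volume :: "(complex \<times> real) set \<Rightarrow> bool" where
  "finite_volume B \<longleftrightarrow> B \<in> sets borel \<and> B \<subseteq> UNIV \<times> {0..} \<and> emeasure lborel B < \<infinity>"

definition rate_one_poisson :: "outcome measure \<Rightarrow> bool" where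
  "rate_one_poisson M \<longleftrightarrow>
     prob_space M \<and> fst \<in> measurable M (PiM UNIV (\<lambda>_. borel)) \<and>
     (\<forall>\<omega>\<in>space M. \<forall>i. 0 \<le> arrival \<omega> i) \<and>
     (\<forall>B n. finite_volume B \<longrightarrow>
        measure M {\<omega>\<in>space M. count_in B \<omega> = of_nat n}
          = measure lborel B ^ n / fact n * exp (- measure lborel B)) \<and>
     (\<forall>\<B>. finite \<B> \<and> disjoint \<B> \<and> (\<forall>B\<in>\<B>. finite_volume B) \<longrightarrow>
        prob_space.indep_vars M (\<lambda>_. borel) count_in \<B>)"

text \<open>
  Only finite-dimensional distributions of the routes are given, so independence of the routes and
  the Poisson process means: conditionally on all the space-time points, the network spanned by
  the first \<open>k\<close> positions has law \<^term>\<open>\<mu> k\<close> at these positions.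
\<close>

definition sampled :: "fdds \<Rightarrow> outcome measure \<Rightarrow> bool" where
  "sampled \<mu> M \<longleftrightarrow>
     rate_one_poisson M \<and>
     (AE \<omega> in M. \<forall>k. feasible {..<k} (position \<omega>) (restrict (snd \<omega>) (pairs {..<k}))) \<and>
     (\<forall>k. (\<lambda>\<omega>. restrict (snd \<omega>) (pairs {..<k})) \<in> measurable M (network_space k)) \<and>
     (\<forall>k. \<forall>C\<in>sets (PiM UNIV (\<lambda>_. borel)). \<forall>A\<in>sets (network_space k).
        emeasure M {\<omega>\<in>space M. fst \<omega> \<in> C \<and> restrict (snd \<omega>) (pairs {..<k}) \<in> A}
          = (\<integral>\<^sup>+ \<omega>. emeasure (\<mu> k (\<lambda>i\<in>{..<k}. position \<omega> i)) A * indicator C (fst \<omega>) \<partial>M))"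

definition arrived :: "real \<Rightarrow> outcome \<Rightarrow> nat set" where
  "arrived \<tau> \<omega> = {i. arrival \<omega> i \<le> \<tau>}"

definition S_edges :: "real \<Rightarrow> outcome \<Rightarrow> complex set" where
  "S_edges \<tau> \<omega> = (\<Union>(i, j)\<in>pairs (arrived \<tau> \<omega>). snd \<omega> (i, j))"

definition E_edges :: "real \<Rightarrow> real \<Rightarrow> outcome \<Rightarrow> complex set" where
  "E_edges \<tau> r \<omega> = (\<Union>(i, j)\<in>pairs (arrived \<tau> \<omega>).
     snd \<omega> (i, j) - (cball (position \<omega> i) r \<union> cball (position \<omega> j) r))"

definition has_edge_intensity :: "outcome measure \<Rightarrow> (outcome \<Rightarrow> complex set) \<Rightarrow> ennreal \<Rightarrow> bool" where
  "has_edge_intensity M E \<iota> \<longleftrightarrow>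
     (\<forall>A\<in>sets borel. (\<integral>\<^sup>+ \<omega>. len (E \<omega> \<inter> A) \<partial>M) = \<iota> * emeasure lborel A)"

text \<open>
  The laws of the edge processes depend on \<^term>\<open>\<mu>\<close> only, hence so do the values \<open>l\<close> and \<open>v\<close>
  below, whatever realisation \<open>M\<close> is used.
\<close>

definition has_ell :: "fdds \<Rightarrow> ennreal \<Rightarrow> bool" where
  "has_ell \<mu> l \<longleftrightarrow> (\<exists>M. sampled \<mu> M \<and> has_edge_intensity M (S_edges 1) l)"

definition has_p :: "fdds \<Rightarrow> real \<Rightarrow> ennreal \<Rightarrow> bool" where
  "has_p \<mu> r v \<longleftrightarrow>
     (\<exists>M p. sampled \<mu> M \<and> (\<forall>\<tau>>0. has_edge_intensity M (E_edges \<tau> r) (p \<tau>)) \<and>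
        (p \<longlongrightarrow> v) at_top)"

definition sirsn :: "fdds \<Rightarrow> bool" where
  "sirsn \<mu> \<longleftrightarrow>
     scale_invariant_fdds \<mu> \<and> 1 < expected_D1 \<mu> \<and> expected_D1 \<mu> < \<infinity> \<and>
     (\<exists>v. has_p \<mu> 1 v \<and> v < \<infinity>)"

definition ell_star :: "real \<Rightarrow> ennreal" where
  "ell_star \<Delta> = Inf {l. \<exists>\<mu>. sirsn \<mu> \<and> expected_D1 \<mu> = ennreal \<Delta> \<and> has_ell \<mu> l}"

end

theory Submission
  imports Defs
begin

text \<open>
  Write \<open>\<epsilon> = \<Delta> - 1\<close> and let \<open>n\<close> be of order \<open>\<epsilon>\<close> to the power \<open>-1/2\<close>. Consider two columns of
  \<open>n\<close> unit discs, at mutual distance \<open>200 n\<close> and with spacing 200 inside a column. For each of the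
  \<open>n\<^sup>2\<close> pairs of a left and a right disc, with probability bounded below both discs contain a
  point of \<open>\<Xi>(1)\<close> and the route between two such points exceeds their distance by at most
  \<open>1 / (100 n)\<close>: by scaling, the mean excess is \<open>\<epsilon>\<close> times the distance, so it is of order
  \<open>\<epsilon> n\<close>, which is of order \<open>1 / n\<close>, and Markov's inequality applies
  (\<open>sampled_short_route_event\<close>).

  Such a route is tight: it stays within bounded distance of the segment joining the two discs,
  and at least half of its length runs in directions within \<open>O(1 / n)\<close> of that of the segment
  (\<open>tight_polyline\<close>). The slopes of the \<open>n\<^sup>2\<close> segments are multiples of \<open>1 / n\<close>. Hence pieces of
  two tight routes that run in the prescribed directions overlap in length 0: if the slopes differ,
  so do the directions of the pieces; if the slopes agree, the routes lie in disjoint strips. The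
  total length inside a disc of radius \<open>1000 n\<close> is therefore at least \<open>100 n\<close> times the number of
  tight routes (\<open>tight_routes_len\<close>). In expectation this is of order \<open>n\<^sup>3\<close>, whereas the area is of
  order \<open>n\<^sup>2\<close>, so the edge-intensity is at least of order \<open>n\<close> (\<open>ell_ge_scale\<close>).
\<close>

section \<open>Lower bounds for length and length under similarities\<close>

lemma lipschitz_image_subset_interval:
  fixes f :: "'a::metric_space \<Rightarrow> real"
  assumes "bounded U" "U \<noteq> {}" and lip: "\<And>x y. dist (f x) (f y) \<le> dist x y"
  obtains a b where "f ` U \<subseteq> {a..b}" "b - a \<le> diameter U" "a \<le> b"
proof -
  have D: "dist x y \<le> diameter U" if "x \<in> U" "y \<in> U" for x y
    using diameter_bounded_bound[OF assms(1) that] .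
  have D': "f x - f y \<le> diameter U" if "x \<in> U" "y \<in> U" for x y
    using D[OF that] lip[of x y] by (auto simp: dist_real_def)
  obtain u where u: "u \<in> U" using assms(2) by auto
  have ba: "bdd_above (f ` U)" 
    by (rule bdd_aboveI[of _ "f u + diameter U"]) (use D' u in \<open>force simp: algebra_simps\<close>)
  have bb: "bdd_below (f ` U)"
    by (rule bdd_belowI[of _ "f u - diameter U"]) (use D' u in \<open>force simp: algebra_simps\<close>)
  have in1: "f x \<in> {Inf (f ` U)..Sup (f ` U)}" if "x \<in> U" for x
    using that ba bb by (auto intro: cINF_lower cSUP_upper)
  have "Sup (f ` U) \<le> Inf (f ` U) + diameter U"
  proof (rule cSup_least)
    show "f ` U \<noteq> {}" using assms by auto
  next
    fix y assume "y \<in> f ` U"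
    then obtain x where x: "x \<in> U" "y = f x" by auto
    have "y - diameter U \<le> Inf (f ` U)"
      by (rule cInf_greatest) (use assms D' x in \<open>force simp: algebra_simps\<close>)+
    then show "y \<le> Inf (f ` U) + diameter U" by simp
  qed
  then show thesis
    using that[of "Inf (f ` U)" "Sup (f ` U)"] in1 u by force
qed

lemma finite_family_compact_separated:
  fixes K :: "'i \<Rightarrow> 'a::heine_borel set"
  assumes "finite I" and "\<And>i. i \<in> I \<Longrightarrow> compact (K i)" and "disjoint_family_on K I"
  obtains d where "d > 0" "\<And>i j x y. \<lbrakk>i \<in> I; j \<in> I; i \<noteq> j; x \<in> K i; y \<in> K j\<rbrakk> \<Longrightarrow> d < dist x y"
proof -
  have "eventually (\<lambda>d. \<forall>i\<in>I. \<forall>j\<in>I. i \<noteq> j \<longrightarrow> (\<forall>x\<in>K i. \<forall>y\<in>K j. d < dist x y)) (at_right (0::real))"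
  proof (intro eventually_ball_finite assms(1) ballI)
    fix i j assume ij: "i \<in> I" "j \<in> I"
    show "eventually (\<lambda>d. i \<noteq> j \<longrightarrow> (\<forall>x\<in>K i. \<forall>y\<in>K j. d < dist x y)) (at_right (0::real))"
    proof (cases "i = j")
      case False
      have "\<exists>d>0. \<forall>x\<in>K i. \<forall>y\<in>K j. d \<le> dist x y"
        using separate_compact_closed[of "K i" "K j"] assms ij False
        by (auto simp: compact_imp_closed disjoint_family_on_def)
      then obtain e where "e > 0" "\<forall>x\<in>K i. \<forall>y\<in>K j. e \<le> dist x y" by auto
      then show ?thesis
        unfolding eventually_at_right_field by (intro exI[of _ e]) force
    qed auto
  qed
  moreover have "eventually (\<lambda>d. d > (0::real)) (at_right 0)"
    by (simp add: eventually_at_right_less)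
  ultimately have "eventually (\<lambda>d. d > 0 \<and> (\<forall>i\<in>I. \<forall>j\<in>I. i \<noteq> j \<longrightarrow> (\<forall>x\<in>K i. \<forall>y\<in>K j. d < dist x y))) (at_right (0::real))"
    by (rule eventually_conj[rotated])
  from eventually_happens'[OF trivial_limit_at_right_real this]
  obtain d where "d > 0" "\<forall>i\<in>I. \<forall>j\<in>I. i \<noteq> j \<longrightarrow> (\<forall>x\<in>K i. \<forall>y\<in>K j. d < dist x y)"
    by auto
  then show thesis using that by blast
qed

text \<open>
  Disjoint compact sets are separated by some \<open>d > 0\<close>, so in a covering by sets of diameter at most
  \<open>d\<close> no set meets two of them, and the sum of the diameters splits. Hence no measurability
  theory for \<^const>\<open>len\<close> is needed to bound the length of a union from below.
\<close>

lemma sum_projections_le_len: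
  fixes K :: "'i \<Rightarrow> complex set" and f :: "'i \<Rightarrow> complex \<Rightarrow> real"
  assumes fin: "finite I" and K: "\<And>i. i \<in> I \<Longrightarrow> compact (K i)"
    and disj: "disjoint_family_on K I" and sub: "\<And>i. i \<in> I \<Longrightarrow> K i \<subseteq> E"
    and lip: "\<And>i x y. dist (f i x) (f i y) \<le> dist x y"
  shows "(\<Sum>i\<in>I. emeasure lborel (f i ` K i)) \<le> len E"
proof -
  obtain d where d: "d > 0" and
    sep: "\<And>i j x y. \<lbrakk>i \<in> I; j \<in> I; i \<noteq> j; x \<in> K i; y \<in> K j\<rbrakk> \<Longrightarrow> d < dist x y"
    using finite_family_compact_separated[OF fin K disj] by metis
  have "(\<Sum>i\<in>I. emeasure lborel (f i ` K i)) \<le> (\<Sum>k. ennreal (diameter (U k)))"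
    if cov: "E \<subseteq> (\<Union>k. U k)" and U: "\<And>k. bounded (U k)" "\<And>k. diameter (U k) \<le> d" for U :: "nat \<Rightarrow> complex set"
  proof -
    define N where "N i = {k. U k \<inter> K i \<noteq> {}}" for i
    have N: "k \<notin> N j" if "i \<in> I" "j \<in> I" "i \<noteq> j" "k \<in> N i" for i j k
    proof
      assume "k \<in> N j"
      then obtain x y where "x \<in> U k" "x \<in> K i" "y \<in> U k" "y \<in> K j"
        using \<open>k \<in> N i\<close> by (auto simp: N_def)
      then show False
        using sep[OF that(1,2,3), of x y] diameter_bounded_bound[OF U(1), of x k y] U(2)[of k] by auto
    qed
    have 1: "emeasure lborel (f i ` K i) \<le> (\<Sum>k. ennreal (diameter (U k)) * indicator (N i) k)" if i: "i \<in> I" for i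
    proof -
      have "\<exists>a b. f i ` U k \<subseteq> {a..b} \<and> b - a \<le> diameter (U k) \<and> a \<le> b" if "k \<in> N i" for k
        proof -
        have "U k \<noteq> {}" using that by (auto simp: N_def)
        then show ?thesis
          using lipschitz_image_subset_interval[OF U(1) _ lip, of k i] by blast
      qed
      then obtain a b where ab: "\<And>k. k \<in> N i \<Longrightarrow> f i ` U k \<subseteq> {a k..b k} \<and> b k - a k \<le> diameter (U k) \<and> a k \<le> b k"
        by metis
      define J where "J k = (if k \<in> N i then {a k..b k} else {})" for k
      have "f i ` K i \<subseteq> (\<Union>k. J k)"
      proof
        fix y assume "y \<in> f i ` K i"
        then obtain x where x: "x \<in> K i" "y = f i x" by auto
        then obtain k where k: "x \<in> U k" using sub[OF i] cov by blast
        then have "k \<in> N i" using x by (auto simp: N_def)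
        then have "y \<in> J k" using ab[of k] x k by (auto simp: J_def)
        then show "y \<in> (\<Union>k. J k)" by blast
      qed
      then have "emeasure lborel (f i ` K i) \<le> emeasure lborel (\<Union>k. J k)"
        by (intro emeasure_mono) (auto simp: J_def intro!: sets.countable_UN)
      also have "\<dots> \<le> (\<Sum>k. emeasure lborel (J k))"
        by (intro emeasure_subadditive_countably) (auto simp: J_def)
      also have "\<dots> \<le> (\<Sum>k. ennreal (diameter (U k)) * indicator (N i) k)"
        by (intro suminf_le) (use ab in \<open>auto simp: J_def indicator_def intro!: ennreal_leI\<close>)
      finally show ?thesis .
    qed
    have "(\<Sum>i\<in>I. emeasure lborel (f i ` K i)) \<le> (\<Sum>i\<in>I. \<Sum>k. ennreal (diameter (U k)) * indicator (N i) k)"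
      by (intro sum_mono 1)
    also have "\<dots> = (\<Sum>k. \<Sum>i\<in>I. ennreal (diameter (U k)) * indicator (N i) k)"
      by (rule suminf_sum[symmetric]) auto
    also have "\<dots> \<le> (\<Sum>k. ennreal (diameter (U k)))"
    proof (intro suminf_le)
      fix k
      show "(\<Sum>i\<in>I. ennreal (diameter (U k)) * indicator (N i) k) \<le> ennreal (diameter (U k))"
      proof (cases "\<exists>i\<in>I. k \<in> N i")
        case True
        then obtain i where i: "i \<in> I" "k \<in> N i" by auto
        have "(\<Sum>j\<in>I. ennreal (diameter (U k)) * indicator (N j) k)
           = (\<Sum>j\<in>I. if j = i then ennreal (diameter (U k)) else 0)"
          using N[of i _ k] i by (intro sum.cong) (auto simp: indicator_def)
        then show ?thesis using fin i by (simp add: sum.delta)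
      qed (auto simp: indicator_def intro!: sum_nonpos)
    qed auto
    finally show ?thesis .
  qed
  then show ?thesis
    unfolding len_def using d
    by (intro SUP_upper2[of d] INF_greatest) auto
qed

text \<open>
  The segments are made disjoint by removing small balls around the finitely many points where
  they meet; each is measured by its orthogonal projection to its own line.
\<close>

lemma sum_segments_le_len:
  fixes p q :: "'i \<Rightarrow> complex"
  assumes fin: "finite I" and sub: "\<And>i. i \<in> I \<Longrightarrow> closed_segment (p i) (q i) \<subseteq> E"
    and meet: "\<And>i j. \<lbrakk>i \<in> I; j \<in> I; i \<noteq> j\<rbrakk> \<Longrightarrow>
                 finite (closed_segment (p i) (q i) \<inter> closed_segment (p j) (q j))"
  shows "ennreal (\<Sum>i\<in>I. dist (p i) (q i)) \<le> len E"
proof -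
  let ?s = "\<lambda>i. closed_segment (p i) (q i)"
  define F where "F = (\<Union>i\<in>I. \<Union>j\<in>I-{i}. ?s i \<inter> ?s j)"
  have F: "finite F" unfolding F_def using fin meet by (intro finite_UN_I) auto
  define f where "f i x = inner (x - p i) (sgn (q i - p i))" for i x
  have lip: "dist (f i x) (f i y) \<le> dist x y" for i x y
  proof -
    have "\<bar>f i x - f i y\<bar> = \<bar>inner (x - y) (sgn (q i - p i))\<bar>"
      by (simp add: f_def inner_diff_left)
    also have "\<dots> \<le> norm (x - y) * norm (sgn (q i - p i))" by (rule Cauchy_Schwarz_ineq2)
    also have "\<dots> \<le> norm (x - y)" by (simp add: norm_sgn)
    finally show ?thesis by (simp add: dist_norm)
  qed
  have cont: "continuous_on A (f i)" for A i unfolding f_def by (intro continuous_intros)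
  have main: "ennreal (\<Sum>i\<in>I. dist (p i) (q i)) \<le> len E + ennreal (card I * (card F * (2 * t)))" if t: "t > 0" for t :: real
  proof -
    define K where "K i = ?s i - (\<Union>x\<in>F. ball x t)" for i
    have K: "compact (K i)" for i
      unfolding K_def by (intro compact_diff compact_segment open_UN) auto
    have disj: "disjoint_family_on K I"
    proof (unfold disjoint_family_on_def, intro ballI impI)
      fix i j assume ij: "i \<in> I" "j \<in> I" "i \<noteq> j"
      then have "?s i \<inter> ?s j \<subseteq> F" by (auto simp: F_def)
      then show "K i \<inter> K j = {}" using t by (force simp: K_def)
    qed
    have mK: "f i ` K i \<in> sets lborel" for i
      using compact_continuous_image[OF cont K] by (simp add: borel_compact)
    have mF: "(\<Union>x\<in>F. {f i x - t..f i x + t}) \<in> sets lborel" for i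
      by (intro sets.finite_UN F) simp
    have 1: "ennreal (dist (p i) (q i)) \<le> emeasure lborel (f i ` K i) + ennreal (card F * (2 * t))" for i
    proof -
      have "{0..dist (p i) (q i)} \<subseteq> f i ` ?s i"
      proof
        fix y assume y: "y \<in> {0..dist (p i) (q i)}"
        show "y \<in> f i ` ?s i"
        proof (cases "p i = q i")
          case True
          then show ?thesis using y by (auto simp: f_def)
        next
          case False
          let ?x = "p i + (y / dist (p i) (q i)) *\<^sub>R (q i - p i)"
          have nz: "norm (q i - p i) \<noteq> 0" using False by simp
          have "?x \<in> ?s i"
            unfolding closed_segment_image_interval
            by (rule image_eqI[of _ _ "y / dist (p i) (q i)"]) (use y False in \<open>auto simp: algebra_simps divide_simps scaleR_conv_of_real\<close>)
          moreover have "f i ?x = y / norm (q i - p i) * (norm (q i - p i))"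
            using nz by (simp add: f_def sgn_div_norm dist_norm norm_minus_commute power2_norm_eq_inner[symmetric] power2_eq_square)
          ultimately show ?thesis using nz by (auto intro!: image_eqI[of _ _ ?x])
        qed
      qed
      also have "f i ` ?s i \<subseteq> f i ` K i \<union> (\<Union>x\<in>F. {f i x - t..f i x + t})"
      proof
        fix y assume "y \<in> f i ` ?s i"
        then obtain x where x: "x \<in> ?s i" "y = f i x" by auto
        show "y \<in> f i ` K i \<union> (\<Union>x\<in>F. {f i x - t..f i x + t})"
        proof (cases "\<exists>z\<in>F. dist z x < t")
          case True
          then obtain z where z: "z \<in> F" "dist z x < t" by auto
          then have "y \<in> {f i z - t..f i z + t}"
            using x lip[of i z x] by (auto simp: dist_real_def)
          then show ?thesis using z by blast
        next
          case False
          then have "x \<in> K i" using x by (auto simp: K_def)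
          then show ?thesis using x by blast
        qed
      qed
      finally have "emeasure lborel {0..dist (p i) (q i)}
            \<le> emeasure lborel (f i ` K i \<union> (\<Union>x\<in>F. {f i x - t..f i x + t}))"
        by (intro emeasure_mono sets.Un mK mF)
      also have "\<dots> \<le> emeasure lborel (f i ` K i) + emeasure lborel (\<Union>x\<in>F. {f i x - t..f i x + t})"
        by (intro emeasure_subadditive mK mF)
      also have "emeasure lborel (\<Union>x\<in>F. {f i x - t..f i x + t}) \<le> (\<Sum>x\<in>F. emeasure lborel {f i x - t..f i x + t})"
        by (intro emeasure_subadditive_finite F) auto
      also have "\<dots> = ennreal (card F * (2 * t))"
        using t by (simp add: ennreal_mult ennreal_of_nat_eq_real_of_nat)
      finally show ?thesis by (simp add: add_mono)
    qed
    have "ennreal (\<Sum>i\<in>I. dist (p i) (q i)) = (\<Sum>i\<in>I. ennreal (dist (p i) (q i)))"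
      by (simp add: sum_ennreal)
    also have "\<dots> \<le> (\<Sum>i\<in>I. emeasure lborel (f i ` K i) + ennreal (card F * (2 * t)))"
      by (intro sum_mono 1)
    also have "\<dots> = (\<Sum>i\<in>I. emeasure lborel (f i ` K i)) + ennreal (card I * (card F * (2 * t)))"
      using t by (simp add: sum.distrib ennreal_mult ennreal_of_nat_eq_real_of_nat)
    also have "\<dots> \<le> len E + ennreal (card I * (card F * (2 * t)))"
      by (intro add_mono sum_projections_le_len fin disj K lip order_refl)
         (use sub in \<open>auto simp: K_def\<close>)
    finally show ?thesis .
  qed
  show ?thesis
  proof (rule ennreal_le_epsilon)
    fix e :: real assume e: "e > 0"
    define t where "t = e / (card I * card F * 2 + 1)"
    have nn: "0 \<le> real (card I) * real (card F) * 2" by simp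
    then have "t > 0" unfolding t_def using e by (intro divide_pos_pos) linarith+
    have "card I * (card F * (2 * t)) = (card I * card F * 2) / (card I * card F * 2 + 1) * e"
      by (simp add: t_def)
    also have "\<dots> \<le> 1 * e"
      using e nn by (intro mult_right_mono divide_le_eq_1_pos[THEN iffD2]) linarith+
    finally have "card I * (card F * (2 * t)) \<le> e" by simp
    then show "ennreal (\<Sum>i\<in>I. dist (p i) (q i)) \<le> len E + ennreal e"
      by (intro order_trans[OF main[OF \<open>t > 0\<close>] add_left_mono[OF ennreal_leI]])
  qed
qed

lemma len_similarity_le:
  fixes T :: "complex \<Rightarrow> complex"
  assumes c: "c > 0" and T: "\<And>x y. dist (T x) (T y) = c * dist x y"
  shows "len (T ` S) \<le> ennreal c * len S"
proof -
  have dT: "bounded (T ` V) \<and> diameter (T ` V) \<le> c * diameter V" if "bounded V" for V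
  proof
    show "bounded (T ` V)"
    proof (cases "V = {}")
      case False
      then obtain v where v: "v \<in> V" by auto
      show ?thesis
        unfolding bounded_def
        by (rule exI[of _ "T v"], rule exI[of _ "c * diameter V"])
           (use diameter_bounded_bound[OF that v] c T in auto)
    qed auto
    show "diameter (T ` V) \<le> c * diameter V"
      by (rule diameter_le)
         (use diameter_bounded_bound[OF that] c T diameter_ge_0[OF that] in \<open>auto simp: dist_norm[symmetric]\<close>)
  qed
  show ?thesis
    unfolding len_def
  proof (rule SUP_least)
    fix d :: real assume d: "d \<in> {0<..}"
    let ?C = "\<lambda>S d. {U :: nat \<Rightarrow> complex set. S \<subseteq> (\<Union>i. U i) \<and> (\<forall>i. bounded (U i) \<and> diameter (U i) \<le> d)}"
    let ?h = "\<lambda>S d. INF U\<in>?C S d. (\<Sum>i. ennreal (diameter (U i)))"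
    have "?h (T ` S) d \<le> ennreal c * (\<Sum>i. ennreal (diameter (U i)))" if U: "U \<in> ?C S (d / c)" for U
    proof -
      have "?h (T ` S) d \<le> (\<Sum>i. ennreal (diameter (T ` U i)))"
      proof (rule INF_lower)
        have "diameter (T ` U i) \<le> d" for i
        proof -
          have "diameter (T ` U i) \<le> c * diameter (U i)" using U dT by auto
          also have "\<dots> \<le> c * (d / c)" using U c by (intro mult_left_mono) auto
          finally show ?thesis using c by simp
        qed
        moreover have "T ` S \<subseteq> (\<Union>i. T ` U i)" using U by blast
        ultimately show "(\<lambda>i. T ` U i) \<in> ?C (T ` S) d" using U dT by simp
      qed
      also have "\<dots> \<le> (\<Sum>i. ennreal c * ennreal (diameter (U i)))"
        using U dT c by (intro suminf_le) (auto simp: ennreal_mult'[symmetric] intro!: ennreal_leI)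
      finally show ?thesis by simp
    qed
    then have "?h (T ` S) d / ennreal c \<le> ?h S (d / c)"
      using c by (intro INF_greatest divide_le_posI_ennreal) (auto simp: mult.commute)
    also have "\<dots> \<le> (SUP d\<in>{0<..}. ?h S d)"
      using c d by (intro SUP_upper) auto
    finally have "?h (T ` S) d / ennreal c * ennreal c \<le> (SUP d\<in>{0<..}. ?h S d) * ennreal c"
      by (rule mult_right_mono) auto
    moreover have "X / ennreal c * ennreal c = X" for X
      using c by (simp add: ennreal_divide_times ennreal_mult_divide_eq)
    ultimately show "?h (T ` S) d \<le> ennreal c * (SUP d\<in>{0<..}. ?h S d)"
      by (simp add: mult.commute)
  qed
qed

lemma len_similarity:
  fixes T :: "complex \<Rightarrow> complex"
  assumes c: "c > 0" and T: "\<And>x y. dist (T x) (T y) = c * dist x y" and "surj T"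
  shows "len (T ` S) = ennreal c * len S"
proof (rule antisym)
  show "len (T ` S) \<le> ennreal c * len S" by (rule len_similarity_le[OF c T])
  have "inj T"
  proof (rule injI)
    fix x y assume "T x = T y"
    then show "x = y" using T[of x y] c by auto
  qed
  have inv: "dist (inv T x) (inv T y) = (1 / c) * dist x y" for x y
    using T[of "inv T x" "inv T y"] c by (simp add: surj_f_inv_f[OF \<open>surj T\<close>])
  have "len S = len (inv T ` T ` S)" using \<open>inj T\<close> by (simp add: image_image)
  also have "\<dots> \<le> ennreal (1 / c) * len (T ` S)"
    by (rule len_similarity_le[OF _ inv]) (use c in auto)
  finally have "ennreal c * len S \<le> ennreal c * (ennreal (1 / c) * len (T ` S))"
    by (rule mult_left_mono) auto
  also have "\<dots> = len (T ` S)"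
    using c by (simp add: mult.assoc[symmetric] ennreal_mult'[symmetric])
  finally show "ennreal c * len S \<le> len (T ` S)" .
qed

section \<open>Polylines inside routes\<close>

lemma route_ends_distinct: 
  assumes "route z z' r" shows "z \<noteq> z'"
proof
  assume "z = z'"
  moreover obtain g where "arc g" "pathstart g = z" "pathfinish g = z'" 
    using assms unfolding route_def by blast
  ultimately show False using arc_distinct_ends by blast
qed

text \<open>
  A route may have infinitely many edges, accumulating at its ends only. Between parameters close
  to 0 and to 1 there are finitely many.
\<close>

lemma route_contains_polyline:
  assumes r: "route z z' r" and e: "e > 0"
  obtains w :: "nat \<Rightarrow> complex" and N where
    "dist (w 0) z < e" "dist (w N) z' < e"
    "\<And>k. k < N \<Longrightarrow> closed_segment (w k) (w (Suc k)) \<subseteq> r"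
    "\<And>j k. \<lbrakk>j < N; k < N; j \<noteq> k\<rbrakk> \<Longrightarrow>
        finite (closed_segment (w j) (w (Suc j)) \<inter> closed_segment (w k) (w (Suc k)))"
proof -
  obtain g I t where *: "arc g \<and> pathstart g = z \<and> pathfinish g = z' \<and> path_image g = r \<and>
        (\<forall>i\<in>I. \<forall>j\<in>I. {i..j} \<subseteq> (I :: int set)) \<and>
        t ` I \<subseteq> {0..1::real} \<and> strict_mono_on I t \<and>
        {0<..<1} \<subseteq> (\<Union>i\<in>{i\<in>I. i + 1 \<in> I}. {t i..t (i + 1)}) \<and>
        (\<forall>i\<in>I. i + 1 \<in> I \<longrightarrow>
           g ` {t i..t (i + 1)} = closed_segment (g (t i)) (g (t (i + 1))))"
    using r unfolding route_def by blast
  then have g: "arc g" "pathstart g = z" "pathfinish g = z'" "path_image g = r"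
    and I: "\<And>i j. i \<in> I \<Longrightarrow> j \<in> I \<Longrightarrow> {i..j} \<subseteq> I"
    and t: "t ` I \<subseteq> {0..1}" "strict_mono_on I t"
    and cov: "{0<..<1} \<subseteq> (\<Union>i\<in>{i\<in>I. i + 1 \<in> I}. {t i..t (i + 1)})"
    and seg: "\<And>i. i \<in> I \<Longrightarrow> i + 1 \<in> I \<Longrightarrow> g ` {t i..t (i + 1)} = closed_segment (g (t i)) (g (t (i + 1)))"
    by blast+
  have inj: "inj_on g {0..1}" and cont: "continuous_on {0..1} g"
    using g(1) by (auto simp: arc_def path_def)
  have g0: "g 0 = z" and g1: "g 1 = z'" using g by (auto simp: pathstart_def pathfinish_def)
  obtain d0 where d0: "d0 > 0" "\<And>x. x \<in> {0..1} \<Longrightarrow> dist x 0 < d0 \<Longrightarrow> dist (g x) z < e"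
    using cont e g0 unfolding continuous_on_iff by (metis atLeastAtMost_iff order_refl zero_le_one)
  obtain d1 where d1: "d1 > 0" "\<And>x. x \<in> {0..1} \<Longrightarrow> dist x 1 < d1 \<Longrightarrow> dist (g x) z' < e"
    using cont e g1 unfolding continuous_on_iff by (metis atLeastAtMost_iff order_refl zero_le_one)
  define \<alpha> where "\<alpha> = min (d0 / 2) (1 / 4)"
  define \<beta> where "\<beta> = max (1 - d1 / 2) (3 / 4)"
  have ab: "0 < \<alpha>" "\<alpha> < d0" "\<alpha> \<le> 1/4" "3/4 \<le> \<beta>" "\<beta> < 1" "1 - \<beta> < d1"
    using d0(1) d1(1) by (auto simp: \<alpha>_def \<beta>_def min_def max_def)
  have "\<alpha> \<in> {0<..<1}" "\<beta> \<in> {0<..<1}" using ab by auto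
  with cov obtain i j where i: "i \<in> I" "i + 1 \<in> I" "\<alpha> \<in> {t i..t (i + 1)}"
    and j: "j \<in> I" "j + 1 \<in> I" "\<beta> \<in> {t j..t (j + 1)}" by blast
  have mono: "t k < t l" if "k \<in> I" "l \<in> I" "k < l" for k l
    using t(2) that by (auto simp: strict_mono_on_def)
  have ij: "i \<le> j"
  proof (rule ccontr)
    assume "\<not> i \<le> j"
    then have "j + 1 = i \<or> j + 1 < i" by auto
    then have "t (j + 1) \<le> t i" using mono[of "j+1" i] i j by force
    then show False using i j ab by auto
  qed
  define N where "N = nat (j + 1 - i)"
  define w where "w k = g (t (i + int k))" for k
  have inI: "i + int k \<in> I" if "k \<le> N" for k
    using I[OF i(1) j(2)] that ij by (auto simp: N_def)
  have t01: "t (i + int k) \<in> {0..1}" if "k \<le> N" for k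
    using inI[OF that] t(1) by auto
  have segk: "closed_segment (w k) (w (Suc k)) = g ` {t (i + int k)..t (i + int (Suc k))}" if "k < N" for k
    using seg[of "i + int k"] inI[of k] inI[of "Suc k"] that by (simp add: w_def algebra_simps)
  show thesis
  proof (rule that[of w N])
    have "0 \<le> t i" "t i \<le> 1" using t(1) i(1) by auto
    then show "dist (w 0) z < e"
      using d0(2)[of "t i"] i ab by (auto simp: w_def dist_real_def)
    have "i + int N = j + 1" using ij by (simp add: N_def)
    moreover have "0 \<le> t (j + 1)" "t (j + 1) \<le> 1" using t(1) j(2) by auto
    ultimately show "dist (w N) z' < e"
      using d1(2)[of "t (j + 1)"] j ab by (auto simp: w_def dist_real_def)
    show "closed_segment (w k) (w (Suc k)) \<subseteq> r" if "k < N" for k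
    proof -
      have "{t (i + int k)..t (i + int (Suc k))} \<subseteq> {0..1}"
        using t01[of k] t01[of "Suc k"] that by auto
      then show ?thesis using g(4) segk[OF that] by (auto simp: path_image_def)
    qed
    have fin: "finite (closed_segment (w a) (w (Suc a)) \<inter> closed_segment (w b) (w (Suc b)))"
      if "a < N" "b < N" "a < b" for a b
    proof -
      let ?A = "\<lambda>k. {t (i + int k)..t (i + int (Suc k))}"
      have sub: "?A k \<subseteq> {0..1}" if "k < N" for k
        using t01[of k] t01[of "Suc k"] that by auto
      have "t (i + int (Suc a)) \<le> t (i + int b)"
      proof (cases "Suc a = b")
        case False
        then show ?thesis using mono[of "i + int (Suc a)" "i + int b"] inI[of "Suc a"] inI[of b] that by force
      qed simp
      then have "?A a \<inter> ?A b \<subseteq> {t (i + int b)}" by auto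
      moreover have "g ` ?A a \<inter> g ` ?A b = g ` (?A a \<inter> ?A b)"
        using inj_on_image_Int[OF inj sub sub] that by simp
      ultimately show ?thesis
        using segk that by (simp add: finite_subset)
    qed
    show "finite (closed_segment (w a) (w (Suc a)) \<inter> closed_segment (w b) (w (Suc b)))"
      if "a < N" "b < N" "a \<noteq> b" for a b
      using fin[of a b] fin[of b a] that by (cases "a < b") (auto simp: Int_commute)
  qed
qed

lemma polyline_le_len:
  assumes "\<And>k. k < N \<Longrightarrow> closed_segment (w k) (w (Suc k)) \<subseteq> r"
    "\<And>j k. \<lbrakk>j < N; k < N; j \<noteq> k\<rbrakk> \<Longrightarrow>
        finite (closed_segment (w j) (w (Suc j)) \<inter> closed_segment (w k) (w (Suc k)))"
  shows "ennreal (\<Sum>k<N. dist (w k) (w (Suc k))) \<le> len r"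
  by (rule sum_segments_le_len) (use assms in auto)

lemma dist_le_sum_dist:
  fixes w :: "nat \<Rightarrow> 'a::metric_space"
  assumes "a \<le> b" shows "dist (w a) (w b) \<le> (\<Sum>k=a..<b. dist (w k) (w (Suc k)))"
  using assms
proof (induction b rule: dec_induct)
  case (step n)
  then show ?case using dist_triangle[of "w a" "w (Suc n)" "w n"] by simp
qed simp

lemma dist_le_len_route:
  assumes "route z z' r" shows "ennreal (dist z z') \<le> len r"
proof (rule ennreal_le_epsilon)
  fix e :: real assume e: "e > 0"
  obtain w N where w: "dist (w 0) z < e / 2" "dist (w N) z' < e / 2"
    "\<And>k. k < N \<Longrightarrow> closed_segment (w k) (w (Suc k)) \<subseteq> r"
    "\<And>j k. \<lbrakk>j < N; k < N; j \<noteq> k\<rbrakk> \<Longrightarrow>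
        finite (closed_segment (w j) (w (Suc j)) \<inter> closed_segment (w k) (w (Suc k)))"
    using route_contains_polyline[OF assms, of "e/2"] e by (metis half_gt_zero)
  have "dist z z' \<le> dist (w 0) (w N) + e"
    using w(1,2) dist_triangle[of z z' "w 0"] dist_triangle[of "w 0" z' "w N"] by (simp add: dist_commute)
  also have "dist (w 0) (w N) \<le> (\<Sum>k<N. dist (w k) (w (Suc k)))"
    using dist_le_sum_dist[of 0 N w] by (simp add: atLeast0LessThan)
  finally have "ennreal (dist z z') \<le> ennreal ((\<Sum>k<N. dist (w k) (w (Suc k))) + e)"
    by (simp add: ennreal_leI)
  also have "\<dots> \<le> len r + ennreal e"
    using polyline_le_len[of N w r] w(3,4) e by (simp add: ennreal_plus sum_nonneg add_mono)
  finally show "ennreal (dist z z') \<le> len r + ennreal e" .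
qed

section \<open>Short polylines between distant discs\<close>

text \<open>
  The cross product of \<open>v\<close> with the vector \<open>(1, m)\<close>: it vanishes exactly on vectors of slope \<open>m\<close>.
\<close>

definition slope_dev :: "real \<Rightarrow> complex \<Rightarrow> real" where
  "slope_dev m v = Im v - m * Re v"

text \<open>
  The product of the norms of \<open>v\<close> and \<open>(1, m)\<close> minus their inner product, that is, the length
  wasted by \<open>v\<close> when travelling in direction \<open>(1, m)\<close>, up to the factor \<open>sqrt (1 + m\<^sup>2)\<close>. Along
  a path it adds up, and the total is controlled by the length and the end points alone.
\<close>

definition excess :: "real \<Rightarrow> complex \<Rightarrow> real" where
  "excess m v = sqrt (1 + m\<^sup>2) * norm v - (Re v + m * Im v)"

lemma slope_dev_diff: "slope_dev m (u - v) = slope_dev m u - slope_dev m v"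
  and slope_dev_scaleR: "slope_dev m (c *\<^sub>R v) = c * slope_dev m v"
  by (simp_all add: slope_dev_def algebra_simps)

lemma slope_dev_bound: "\<bar>m\<bar> \<le> 1 \<Longrightarrow> \<bar>slope_dev m v\<bar> \<le> 2 * norm v"
proof -
  assume "\<bar>m\<bar> \<le> 1"
  then have "\<bar>m * Re v\<bar> \<le> 1 * \<bar>Re v\<bar>"
    unfolding abs_mult by (intro mult_right_mono) auto
  then show ?thesis
    using abs_Re_le_cmod[of v] abs_Im_le_cmod[of v] by (simp add: slope_dev_def)
qed

lemma slope_dev_excess_identity:
  "(slope_dev m v)\<^sup>2 = excess m v * (sqrt (1 + m\<^sup>2) * norm v + (Re v + m * Im v))"
proof -
  have "excess m v * (sqrt (1 + m\<^sup>2) * norm v + (Re v + m * Im v)) 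
        = (sqrt (1 + m\<^sup>2))\<^sup>2 * (norm v)\<^sup>2 - (Re v + m * Im v)\<^sup>2"
    unfolding excess_def by (simp add: power2_eq_square algebra_simps)
  also have "(sqrt (1 + m\<^sup>2))\<^sup>2 = 1 + m\<^sup>2" by simp
  also have "(1 + m\<^sup>2) * (norm v)\<^sup>2 - (Re v + m * Im v)\<^sup>2 = (slope_dev m v)\<^sup>2"
    unfolding cmod_power2 by (simp add: slope_dev_def power2_eq_square algebra_simps)
  finally show ?thesis by simp
qed

lemma dot_le_norm: "Re v + m * Im v \<le> sqrt (1 + m\<^sup>2) * norm v"
  using Cauchy_Schwarz_ineq2[of "Complex 1 m" v]
  by (simp add: inner_complex_def cmod_def)

lemma excess_nonneg: "0 \<le> excess m v"
  using dot_le_norm[of v m] by (simp add: excess_def)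

lemma sqrt_slope_bounds: "\<bar>m\<bar> \<le> 1 \<Longrightarrow> 1 \<le> sqrt (1 + m\<^sup>2) \<and> sqrt (1 + m\<^sup>2) \<le> 3 / 2"
proof
  assume "\<bar>m\<bar> \<le> 1"
  then have "m\<^sup>2 \<le> 1" by (simp add: abs_square_le_1)
  then show "sqrt (1 + m\<^sup>2) \<le> 3 / 2" by (intro real_le_lsqrt) (auto simp: power2_eq_square)
qed auto

text \<open>
  Deviation from the direction \<open>(1, m)\<close> costs length, quadratically. This yields both properties of
  a tight path: applied to the vector from the start to a point of the path, it keeps the
  path close to the straight line; applied to the edges, it bounds the length of those that
  deviate in direction.
\<close>

lemma slope_dev_le_excess:
  assumes "\<bar>m\<bar> \<le> 1" shows "(slope_dev m v)\<^sup>2 \<le> 3 * norm v * excess m v"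
proof -
  have "sqrt (1 + m\<^sup>2) * norm v \<le> 3 / 2 * norm v"
    using sqrt_slope_bounds[OF assms] by (intro mult_right_mono) auto
  then have "sqrt (1 + m\<^sup>2) * norm v + (Re v + m * Im v) \<le> 3 * norm v"
    using dot_le_norm[of v m] by linarith
  then show ?thesis
    unfolding slope_dev_excess_identity using excess_nonneg[of m v] by (simp add: mult_left_mono mult.commute)
qed

lemma excess_add: "excess m (u + v) \<le> excess m u + excess m v"
proof -
  have "sqrt (1 + m\<^sup>2) * norm (u + v) \<le> sqrt (1 + m\<^sup>2) * (norm u + norm v)"
    by (intro mult_left_mono norm_triangle_ineq) auto
  then show ?thesis by (simp add: excess_def algebra_simps)
qed

lemma excess_scaleR: "0 \<le> c \<Longrightarrow> excess m (c *\<^sub>R v) = c * excess m v"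
  by (simp add: excess_def algebra_simps)

lemma excess_le_sum_excess:
  assumes "a \<le> b" shows "excess m (w b - w a) \<le> (\<Sum>k=a..<b. excess m (w (Suc k) - w k))"
  using assms
proof (induction b rule: dec_induct)
  case base
  then show ?case by (simp add: excess_def)
next
  case (step n)
  then show ?case using excess_add[of m "w n - w a" "w (Suc n) - w n"] by simp
qed

lemma sum_excess:
  "(\<Sum>k<N. excess m (w (Suc k) - w k))
     = sqrt (1 + m\<^sup>2) * (\<Sum>k<N. dist (w k) (w (Suc k))) - (Re (w N - w 0) + m * Im (w N - w 0))"
  by (induction N) (simp_all add: excess_def dist_norm norm_minus_commute algebra_simps)

text \<open>
  A polyline between discs of radius 2 around \<open>P\<close> and \<open>P + 200 n (1, m)\<close> that is almost as short
  as possible: the edges on lines within angle \<open>O(1 / n)\<close> of the slope \<open>m\<close> have total length of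
  order \<open>n\<close>, and the whole polyline lies in a strip of bounded width. The factor 200 is chosen
  large compared with the radius of the discs; it exceeds the width of the strip.
\<close>

lemma tight_polyline:
  fixes w :: "nat \<Rightarrow> complex" and n m :: real and P :: complex
  assumes n: "n \<ge> 1" and m: "\<bar>m\<bar> \<le> 1"
    and w0: "dist (w 0) P \<le> 2" and wN: "dist (w N) (P + (200 * n) *\<^sub>R Complex 1 m) \<le> 2"
    and len: "(\<Sum>k<N. dist (w k) (w (Suc k))) \<le> dist (w 0) (w N) + 1 / (50 * n)"
  shows "100 * n \<le> (\<Sum>k\<in>{k. k < N \<and> \<bar>slope_dev m (w (Suc k) - w k)\<bar> < norm (w (Suc k) - w k) / (8 * n)}.
                       dist (w k) (w (Suc k)))" (is "_ \<le> sum ?l ?G")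
    and "\<lbrakk>k < N; x \<in> closed_segment (w k) (w (Suc k))\<rbrakk> \<Longrightarrow>
           \<bar>slope_dev m (x - P)\<bar> \<le> 25 \<and> dist x P \<le> 420 * n"
proof -
  define D where "D = w N - w 0"
  define e where "e = D - (200 * n) *\<^sub>R Complex 1 m"
  have e: "norm e \<le> 4"
  proof -
    have "e = (w N - (P + (200 * n) *\<^sub>R Complex 1 m)) - (w 0 - P)" by (simp add: e_def D_def)
    then show ?thesis
      using w0 wN norm_triangle_ineq4[of "w N - (P + (200 * n) *\<^sub>R Complex 1 m)" "w 0 - P"]
      by (simp add: dist_norm)
  qed
  have mm: "\<bar>m * y\<bar> \<le> \<bar>y\<bar>" for y 
    using mult_right_mono[OF m, of "\<bar>y\<bar>"] by (simp add: abs_mult)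
  have eRI: "\<bar>Re e\<bar> \<le> 4" "\<bar>Im e\<bar> \<le> 4" "\<bar>m * Re e\<bar> \<le> 4" "\<bar>m * Im e\<bar> \<le> 4"
    using abs_Re_le_cmod[of e] abs_Im_le_cmod[of e] e mm[of "Re e"] mm[of "Im e"] by linarith+
  have D: "Re D = 200 * n + Re e" "Im D = 200 * n * m + Im e" by (simp_all add: e_def)
  have normD: "196 * n \<le> norm D" "norm D \<le> 410 * n"
  proof -
    have "200 * n - 4 \<le> norm D" using complex_Re_le_cmod[of D] D eRI by linarith
    then show "196 * n \<le> norm D" using n by linarith
    have "\<bar>n * m\<bar> \<le> n" using mm[of n] n by (simp add: mult.commute)
    then have "\<bar>Re D\<bar> + \<bar>Im D\<bar> \<le> 410 * n" using D eRI n by (simp add: mult.assoc)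
    then show "norm D \<le> 410 * n" using cmod_le[of D] by linarith
  qed
  have exD: "excess m D \<le> 8 / (25 * n)"
  proof -
    have "\<bar>slope_dev m D\<bar> \<le> 8" using eRI by (simp add: slope_dev_def D algebra_simps abs_le_iff)
    then have 1: "(slope_dev m D)\<^sup>2 \<le> 64" using abs_le_square_iff[of "slope_dev m D" 8] by simp
    have "0 \<le> 200 * n * (m * m)" using n by (intro mult_nonneg_nonneg zero_le_square) auto
    then have "0 \<le> m * (200 * n * m)" by (simp only: mult_ac)
    then have "Re D + m * Im D \<ge> 200 * n - 8"
      using eRI unfolding D distrib_left by linarith
    then have "sqrt (1 + m\<^sup>2) * norm D + (Re D + m * Im D) \<ge> 200 * n"
      using dot_le_norm[of D m] n by linarith
    then have "excess m D * (200 * n) \<le> (slope_dev m D)\<^sup>2"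
      unfolding slope_dev_excess_identity by (rule mult_left_mono[OF _ excess_nonneg])
    then have "excess m D * (200 * n) \<le> 64" using 1 by linarith
    then show ?thesis using n by (simp add: field_simps)
  qed
  \<comment> \<open>The total excess of the edges is of order \<open>1 / n\<close>.\<close>
  define \<beta> where "\<beta> = (\<Sum>k<N. excess m (w (Suc k) - w k))"
  have \<beta>: "\<beta> \<le> 7 / (20 * n)"
  proof -
    have "\<beta> \<le> sqrt (1 + m\<^sup>2) * (norm D + 1 / (50 * n)) - (Re D + m * Im D)"
      unfolding \<beta>_def sum_excess D_def[symmetric]
      using len sqrt_slope_bounds[OF m] by (intro diff_right_mono mult_left_mono) (auto simp: D_def dist_norm norm_minus_commute)
    also have "\<dots> = excess m D + sqrt (1 + m\<^sup>2) * (1 / (50 * n))"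
      by (simp add: excess_def algebra_simps)
    also have "\<dots> \<le> 8 / (25 * n) + 3 / 2 * (1 / (50 * n))"
      using sqrt_slope_bounds[OF m] n by (intro add_mono exD mult_right_mono) auto
    also have "\<dots> = 7 / (20 * n)" using n by (simp add: field_simps)
    finally show ?thesis .
  qed
  have normsum: "norm D \<le> sum ?l {..<N}"
    using dist_le_sum_dist[of 0 N w] by (simp add: D_def dist_norm norm_minus_commute atLeast0LessThan)
  show "100 * n \<le> sum ?l ?G"
  proof -
    \<comment> \<open>An edge of the wrong direction has excess at least \<open>1 / (192 n\<^sup>2)\<close> times its length.\<close>
    have bad: "?l k \<le> 192 * n\<^sup>2 * excess m (w (Suc k) - w k)" if "k \<in> {..<N} - ?G" for k
    proof (cases "w (Suc k) = w k")
      case True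
      then show ?thesis by (simp add: excess_nonneg excess_def)
    next
      case False
      define v where "v = w (Suc k) - w k"
      have v: "norm v > 0" using False by (simp add: v_def)
      have "norm v / (8 * n) \<le> \<bar>slope_dev m v\<bar>" using that by (auto simp: v_def)
      then have "(norm v / (8 * n))\<^sup>2 \<le> \<bar>slope_dev m v\<bar>\<^sup>2"
        using n by (intro power_mono) auto
      also have "\<dots> \<le> 3 * norm v * excess m v" using slope_dev_le_excess[OF m] by simp
      finally have "norm v * norm v \<le> norm v * (192 * n\<^sup>2 * excess m v)"
        using n by (simp add: power_divide power_mult_distrib divide_simps power2_eq_square algebra_simps)
      then have "norm v \<le> 192 * n\<^sup>2 * excess m v" using v by simp
      then show ?thesis by (simp add: v_def dist_norm norm_minus_commute)
    qed
    have "sum ?l ({..<N} - ?G) \<le> (\<Sum>k\<in>{..<N} - ?G. 192 * n\<^sup>2 * excess m (w (Suc k) - w k))"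
      by (intro sum_mono bad)
    also have "\<dots> \<le> (\<Sum>k<N. 192 * n\<^sup>2 * excess m (w (Suc k) - w k))"
      by (intro sum_mono2) (auto intro!: mult_nonneg_nonneg excess_nonneg)
    also have "\<dots> = 192 * n\<^sup>2 * \<beta>" by (simp add: \<beta>_def sum_distrib_left)
    also have "\<dots> \<le> 192 * n\<^sup>2 * (7 / (20 * n))" by (intro mult_left_mono \<beta>) auto
    also have "\<dots> = 67.2 * n" using n by (simp add: power2_eq_square)
    finally have "sum ?l ({..<N} - ?G) \<le> 67.2 * n" .
    moreover have "sum ?l {..<N} = sum ?l ({..<N} - ?G) + sum ?l ?G"
      by (rule sum.subset_diff) auto
    ultimately show ?thesis using normsum normD n by linarith
  qed
  show "\<bar>slope_dev m (x - P)\<bar> \<le> 25 \<and> dist x P \<le> 420 * n"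
    if k: "k < N" and x: "x \<in> closed_segment (w k) (w (Suc k))"
  proof -
    obtain u where u: "0 \<le> u" "u \<le> 1" "x = (1 - u) *\<^sub>R w k + u *\<^sub>R w (Suc k)"
      using x by (auto simp: in_segment)
    have x0: "x - w 0 = (w k - w 0) + u *\<^sub>R (w (Suc k) - w k)"
      using u by (simp add: algebra_simps)
    have "excess m (x - w 0) \<le> excess m (w k - w 0) + u * excess m (w (Suc k) - w k)"
      unfolding x0 using excess_add[of m "w k - w 0" "u *\<^sub>R (w (Suc k) - w k)"] u by (simp add: excess_scaleR)
    also have "\<dots> \<le> (\<Sum>k=0..<k. excess m (w (Suc k) - w k)) + 1 * excess m (w (Suc k) - w k)"
      using u by (intro add_mono excess_le_sum_excess mult_right_mono excess_nonneg) auto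
    also have "\<dots> = (\<Sum>k<Suc k. excess m (w (Suc k) - w k))" by (simp add: atLeast0LessThan)
    also have "\<dots> \<le> \<beta>" unfolding \<beta>_def using k by (intro sum_mono2 excess_nonneg) auto
    finally have ex: "excess m (x - w 0) \<le> 7 / (20 * n)" using \<beta> by linarith
    have "norm (x - w 0) \<le> norm (w k - w 0) + u * norm (w (Suc k) - w k)"
      unfolding x0 using norm_triangle_ineq[of "w k - w 0" "u *\<^sub>R (w (Suc k) - w k)"] u by simp
    also have "\<dots> \<le> (\<Sum>k=0..<k. ?l k) + 1 * ?l k"
      using u dist_le_sum_dist[of 0 k w] by (intro add_mono mult_right_mono) (auto simp: dist_norm norm_minus_commute mult_left_le_one_le)
    also have "\<dots> = (\<Sum>k<Suc k. ?l k)" by (simp add: atLeast0LessThan)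
    also have "\<dots> \<le> (\<Sum>k<N. ?l k)" using k by (intro sum_mono2) auto
    also have "\<dots> \<le> norm D + 1 / (50 * n)" using len by (simp add: D_def dist_norm norm_minus_commute)
    also have "\<dots> \<le> 411 * n"
    proof -
      have "1 / (50 * n) \<le> 1" using n by (simp add: field_simps)
      then show ?thesis using normD n by linarith
    qed
    finally have nx: "norm (x - w 0) \<le> 411 * n" .
    have "(slope_dev m (x - w 0))\<^sup>2 \<le> 3 * norm (x - w 0) * excess m (x - w 0)"
      by (rule slope_dev_le_excess[OF m])
    also have "\<dots> \<le> 3 * (411 * n) * (7 / (20 * n))"
      using nx ex n by (intro mult_mono) (auto simp: excess_nonneg)
    also have "\<dots> \<le> 21\<^sup>2" using n by simp
    finally have "\<bar>slope_dev m (x - w 0)\<bar> \<le> 21" using abs_le_square_iff[of "slope_dev m (x - w 0)" 21] by simp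
    moreover have "\<bar>slope_dev m (w 0 - P)\<bar> \<le> 4"
      using slope_dev_bound[OF m, of "w 0 - P"] w0 by (simp add: dist_norm)
    ultimately have "\<bar>slope_dev m (x - P)\<bar> \<le> 25" using slope_dev_diff[of m x "w 0"] slope_dev_diff[of m "w 0" P] slope_dev_diff[of m x P] by linarith
    moreover have "dist x P \<le> 420 * n" using dist_triangle[of x P "w 0"] nx w0 n by (simp add: dist_norm)
    ultimately show ?thesis by simp
  qed
qed

lemma good_slopes_distinct:
  fixes n m m' :: real
  assumes n: "n \<ge> 1" and m: "\<bar>m\<bar> \<le> 1" and mm': "1 / n \<le> \<bar>m - m'\<bar>"
    and g: "\<bar>slope_dev m v\<bar> < norm v / (8 * n)" and g': "\<bar>slope_dev m' v\<bar> < norm v / (8 * n)"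
  shows False
proof -
  have v: "norm v > 0" using g n by (cases "v = 0") (auto simp: slope_dev_def)
  have "norm v / (8 * n) \<le> norm v / 8" using n v by (simp add: field_simps)
  then have "\<bar>slope_dev m v\<bar> < norm v / 8" using g by linarith
  moreover have "\<bar>m * Re v\<bar> \<le> \<bar>Re v\<bar>" using mult_right_mono[OF m, of "\<bar>Re v\<bar>"] by (simp add: abs_mult)
  ultimately have "\<bar>Im v\<bar> \<le> \<bar>Re v\<bar> + norm v / 8" unfolding slope_dev_def by linarith
  then have R: "norm v / 4 \<le> \<bar>Re v\<bar>" using cmod_le[of v] v by linarith
  have "slope_dev m' v - slope_dev m v = (m - m') * Re v" by (simp add: slope_dev_def algebra_simps)
  then have "\<bar>m - m'\<bar> * \<bar>Re v\<bar> < norm v / (4 * n)"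
    using g g' unfolding abs_mult[symmetric] by (simp add: field_simps)
  moreover have "1 / n * (norm v / 4) \<le> \<bar>m - m'\<bar> * \<bar>Re v\<bar>"
    using mm' R n v by (intro mult_mono) auto
  ultimately show False using n by (simp add: field_simps)
qed

text \<open>
  Slopes that differ by at least \<open>1 / n\<close> have disjoint windows of directions, so that segments with
  directions in the two windows are not parallel.
\<close>

lemma good_segments_meet:
  fixes n m m' :: real
  assumes "n \<ge> 1" "\<bar>m\<bar> \<le> 1" "1 / n \<le> \<bar>m - m'\<bar>"
    and g: "\<bar>slope_dev m (q - p)\<bar> < norm (q - p) / (8 * n)"
    and g': "\<bar>slope_dev m' (q' - p')\<bar> < norm (q' - p') / (8 * n)"
  shows "finite (closed_segment p q \<inter> closed_segment p' q')"
proof -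
  have good: "\<bar>slope_dev m (y - x)\<bar> < norm (y - x) / (8 * n)"
    if pq: "\<bar>slope_dev m (q - p)\<bar> < norm (q - p) / (8 * n)"
      and x: "x \<in> closed_segment p q" and y: "y \<in> closed_segment p q" and "x \<noteq> y" for x y p q :: complex and m
  proof -
    obtain u u' where xy: "x = (1 - u) *\<^sub>R p + u *\<^sub>R q" "y = (1 - u') *\<^sub>R p + u' *\<^sub>R q"
      using x y unfolding in_segment by blast
    have yx: "y - x = (u' - u) *\<^sub>R (q - p)" unfolding xy by (simp add: algebra_simps)
    then have "u' \<noteq> u" using \<open>x \<noteq> y\<close> by auto
    then show ?thesis
      unfolding yx slope_dev_scaleR using mult_strict_left_mono[OF pq, of "\<bar>u' - u\<bar>"] by (simp add: abs_mult)
  qed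
  have "x = y" if "x \<in> closed_segment p q \<inter> closed_segment p' q'" "y \<in> closed_segment p q \<inter> closed_segment p' q'" for x y
    using good[OF g, of x y] good[OF g', of x y] that good_slopes_distinct[OF assms(1-3), of "y - x"] by blast
  then show ?thesis
    by (metis finite.emptyI finite_insert finite_subset insertI1 subsetI)
qed

section \<open>Length of a union of tight routes\<close>

text \<open>
  The pair \<open>(b, c)\<close> stands for the \<open>b\<close>-th disc of the left column and the \<open>c\<close>-th disc of the right
  column, joined by a segment of slope \<open>(c - b) / n\<close>.
\<close>

lemma tight_routes_len:
  fixes n :: nat and J :: "(nat \<times> nat) set" and y y' :: "nat \<times> nat \<Rightarrow> complex"
  assumes n: "n \<ge> 1" and J: "J \<subseteq> {..<n} \<times> {..<n}"
    and y: "\<And>b c. (b, c) \<in> J \<Longrightarrow> dist (y (b, c)) (Complex 0 (200 * real b)) \<le> 1"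
    and y': "\<And>b c. (b, c) \<in> J \<Longrightarrow> dist (y' (b, c)) (Complex (200 * real n) (200 * real c)) \<le> 1"
    and r: "\<And>p. p \<in> J \<Longrightarrow> route (y p) (y' p) (r p)"
    and len_r: "\<And>p. p \<in> J \<Longrightarrow> len (r p) \<le> ennreal (dist (y p) (y' p) + 1 / (100 * real n))"
    and E: "\<And>p. p \<in> J \<Longrightarrow> r p \<subseteq> E"
  shows "ennreal (real (card J) * (100 * real n)) \<le> len (E \<inter> ball 0 (1000 * real n))"
proof -
  have n1: "real n \<ge> 1" using n by simp
  define P where "P p = Complex 0 (200 * real (fst p))" for p :: "nat \<times> nat"
  define m where "m p = (real (snd p) - real (fst p)) / n" for p :: "nat \<times> nat"
  have finJ: "finite J" using J finite_subset by blast
  have m1: "\<bar>m p\<bar> \<le> 1" if "p \<in> J" for p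
    using that J n1 by (auto simp: m_def abs_le_iff divide_simps)
  have PQ: "P p + (200 * real n) *\<^sub>R Complex 1 (m p) = Complex (200 * real n) (200 * real (snd p))" for p
    using n1 by (simp add: P_def m_def complex_eq_iff field_simps)
  have "\<exists>w N. dist (w 0) (y p) < 1 / (400 * real n) \<and> dist (w N) (y' p) < 1 / (400 * real n) \<and>
          (\<forall>k<N. closed_segment (w k) (w (Suc k)) \<subseteq> r p) \<and>
          (\<forall>j<N. \<forall>k<N. j \<noteq> k \<longrightarrow>
            finite (closed_segment (w j) (w (Suc j)) \<inter> closed_segment (w k) (w (Suc k))))"
    if pJ: "p \<in> J" for p
  proof -
    have pos: "0 < 1 / (400 * real n)" using n1 by simp
    show ?thesis
    proof (rule route_contains_polyline[OF r[OF pJ] pos])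
      fix w N
      assume "dist (w 0) (y p) < 1 / (400 * real n)" "dist (w N) (y' p) < 1 / (400 * real n)"
        "\<And>k. k < N \<Longrightarrow> closed_segment (w k) (w (Suc k)) \<subseteq> r p"
        "\<And>j k. \<lbrakk>j < N; k < N; j \<noteq> k\<rbrakk> \<Longrightarrow>
            finite (closed_segment (w j) (w (Suc j)) \<inter> closed_segment (w k) (w (Suc k)))"
      then show ?thesis by (intro exI[of _ w] exI[of _ N]) simp
    qed
  qed
  then obtain w N where w: "\<And>p. p \<in> J \<Longrightarrow> dist (w p 0) (y p) < 1 / (400 * real n)"
      "\<And>p. p \<in> J \<Longrightarrow> dist (w p (N p)) (y' p) < 1 / (400 * real n)"
      "\<And>p k. p \<in> J \<Longrightarrow> k < N p \<Longrightarrow> closed_segment (w p k) (w p (Suc k)) \<subseteq> r p"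
      "\<And>p j k. p \<in> J \<Longrightarrow> j < N p \<Longrightarrow> k < N p \<Longrightarrow> j \<noteq> k \<Longrightarrow>
            finite (closed_segment (w p j) (w p (Suc j)) \<inter> closed_segment (w p k) (w p (Suc k)))"
    by metis
  have small: "1 / (400 * real n) \<le> 1" using n1 by (simp add: field_simps)
  have h0: "dist (w p 0) (P p) \<le> 2" if "p \<in> J" for p
    using w(1)[OF that] y[of "fst p" "snd p"] that small dist_triangle[of "w p 0" "P p" "y p"]
    by (simp add: P_def)
  have hN: "dist (w p (N p)) (P p + (200 * real n) *\<^sub>R Complex 1 (m p)) \<le> 2" if "p \<in> J" for p
    unfolding PQ using w(2)[OF that] y'[of "fst p" "snd p"] that small
      dist_triangle[of "w p (N p)" "Complex (200 * real n) (200 * real (snd p))" "y' p"]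
    by simp
  have tight: "(\<Sum>k<N p. dist (w p k) (w p (Suc k))) \<le> dist (w p 0) (w p (N p)) + 1 / (50 * real n)"
    if "p \<in> J" for p
  proof -
    have "ennreal (\<Sum>k<N p. dist (w p k) (w p (Suc k))) \<le> len (r p)"
      by (rule polyline_le_len) (use w that in auto)
    also have "\<dots> \<le> ennreal (dist (y p) (y' p) + 1 / (100 * real n))" by (rule len_r[OF that])
    finally have "(\<Sum>k<N p. dist (w p k) (w p (Suc k))) \<le> dist (y p) (y' p) + 1 / (100 * real n)"
      by (subst (asm) ennreal_le_iff) auto
    moreover have "dist (y p) (y' p) \<le> dist (w p 0) (w p (N p)) + 2 * (1 / (400 * real n))"
      using w(1,2)[OF that] dist_triangle[of "y p" "y' p" "w p 0"] dist_triangle[of "w p 0" "y' p" "w p (N p)"]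
      by (simp add: dist_commute)
    moreover have "1 / (100 * real n) + 2 * (1 / (400 * real n)) \<le> 1 / (50 * real n)" using n1 by (simp add: field_simps)
    ultimately show ?thesis by linarith
  qed
  note T = tight_polyline[OF n1 m1 h0 hN tight]
  define G where "G p = {k. k < N p \<and> \<bar>slope_dev (m p) (w p (Suc k) - w p k)\<bar>
                               < norm (w p (Suc k) - w p k) / (8 * real n)}" for p
  have finG: "finite (G p)" for p by (simp add: G_def)
  define I where "I = Sigma J G"
  define pp where "pp x = w (fst x) (snd x)" for x :: "(nat \<times> nat) \<times> nat"
  define qq where "qq x = w (fst x) (Suc (snd x))" for x :: "(nat \<times> nat) \<times> nat"
  have "real (card J) * (100 * real n) \<le> (\<Sum>p\<in>J. \<Sum>k\<in>G p. dist (w p k) (w p (Suc k)))"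
    using sum_mono[of J "\<lambda>_. 100 * real n" "\<lambda>p. \<Sum>k\<in>G p. dist (w p k) (w p (Suc k))"] T(1)
    by (simp add: G_def)
  also have "\<dots> = (\<Sum>x\<in>I. dist (pp x) (qq x))"
    unfolding I_def by (subst sum.Sigma[OF finJ]) (auto simp: finG pp_def qq_def case_prod_unfold)
  finally have "ennreal (real (card J) * (100 * real n)) \<le> ennreal (\<Sum>x\<in>I. dist (pp x) (qq x))"
    by (rule ennreal_leI)
  also have "\<dots> \<le> len (E \<inter> ball 0 (1000 * real n))"
  proof (rule sum_segments_le_len)
    show "finite I" unfolding I_def using finJ finG by auto
    show "closed_segment (pp x) (qq x) \<subseteq> E \<inter> ball 0 (1000 * real n)" if xI: "x \<in> I" for x
    proof
      obtain p k where x: "x = (p, k)" "p \<in> J" "k < N p" using xI unfolding I_def G_def by blast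
      fix u assume u: "u \<in> closed_segment (pp x) (qq x)"
      then have "u \<in> r p" using w(3)[OF x(2,3)] x by (auto simp: pp_def qq_def)
      moreover have "dist u (P p) \<le> 420 * real n"
        using T(2)[OF x(2,2,2,2,3), of u] u x by (auto simp: pp_def qq_def)
      moreover have "dist (P p) 0 \<le> 200 * real n"
        using x(2) J cmod_le[of "P p"] by (auto simp: P_def)
      ultimately show "u \<in> E \<inter> ball 0 (1000 * real n)"
        using E[OF x(2)] dist_triangle[of u 0 "P p"] n1 by (auto simp: dist_commute)
    qed
    show "finite (closed_segment (pp x) (qq x) \<inter> closed_segment (pp x') (qq x'))"
      if xI: "x \<in> I" and xI': "x' \<in> I" and "x \<noteq> x'" for x x'
    proof -
      obtain p k where x: "x = (p, k)" "p \<in> J" "k < N p" "k \<in> G p" using xI unfolding I_def G_def by blast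
      obtain p' k' where x': "x' = (p', k')" "p' \<in> J" "k' < N p'" "k' \<in> G p'" using xI' unfolding I_def G_def by blast
      consider "p = p'" | "p \<noteq> p'" "m p = m p'" | "m p \<noteq> m p'" by auto
      then show ?thesis
      proof cases
        \<comment> \<open>two edges of one route\<close>
        case 1
        then have "k \<noteq> k'" using \<open>x \<noteq> x'\<close> x x' by auto
        then show ?thesis using w(4)[OF x(2,3), of k'] x x' 1 by (simp add: pp_def qq_def)
      next
        \<comment> \<open>equal slopes: the routes run in disjoint parallel strips\<close>
        case 2
        have "fst p \<noteq> fst p'"
        proof
          assume "fst p = fst p'"
          then have "snd p = snd p'" using 2(2) n1 by (simp add: m_def)
          with \<open>fst p = fst p'\<close> show False using 2(1) by (simp add: prod_eq_iff)
        qed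
        then have far: "1 \<le> \<bar>real (fst p) - real (fst p')\<bar>" by linarith
        have "closed_segment (pp x) (qq x) \<inter> closed_segment (pp x') (qq x') = {}"
        proof (rule ccontr)
          assume "\<not> ?thesis"
          then obtain u where u: "u \<in> closed_segment (pp x) (qq x)" "u \<in> closed_segment (pp x') (qq x')"
            by auto
          have "\<bar>slope_dev (m p) (u - P p)\<bar> \<le> 25"
            using T(2)[OF x(2,2,2,2,3), of u] u x by (auto simp: pp_def qq_def)
          moreover have "\<bar>slope_dev (m p) (u - P p')\<bar> \<le> 25"
            using T(2)[OF x'(2,2,2,2,3), of u] u x' 2(2) by (auto simp: pp_def qq_def)
          moreover have "slope_dev (m p) (u - P p') - slope_dev (m p) (u - P p) = 200 * (real (fst p) - real (fst p'))"
            by (simp add: slope_dev_def P_def algebra_simps)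
          ultimately have "\<bar>200 * (real (fst p) - real (fst p'))\<bar> \<le> 50" by linarith
          then show False using far by (simp add: abs_mult)
        qed
        then show ?thesis by simp
      next
        \<comment> \<open>different slopes: the edges are not parallel\<close>
        case 3
        have "real (snd p) - real (fst p) \<noteq> real (snd p') - real (fst p')"
          using 3 by (auto simp: m_def)
        then have "(int (snd p) - int (fst p)) - (int (snd p') - int (fst p')) \<noteq> 0" (is "?D \<noteq> 0")
          by linarith
        then have "real_of_int 1 \<le> real_of_int \<bar>?D\<bar>" unfolding of_int_le_iff by linarith
        then have "1 \<le> \<bar>(real (snd p) - real (fst p)) - (real (snd p') - real (fst p'))\<bar>" by simp
        then have "1 / n \<le> \<bar>m p - m p'\<bar>"
          using n1 by (simp add: m_def diff_divide_distrib[symmetric] divide_right_mono)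
        from good_segments_meet[OF n1 m1[OF x(2)] this]
        show ?thesis using x x' by (simp add: pp_def qq_def G_def)
      qed
    qed
  qed
  finally show ?thesis .
qed

section \<open>Law of the length of a route\<close>

lemma space_network_space:
  "space (network_space k) = {N. \<exists>z. inj_on z {..<k} \<and> feasible {..<k} z N}"
  unfolding network_space_def Let_def by (rule space_measure_of) auto

lemma measurable_len_route:
  assumes "i < k" "j < k" "i \<noteq> j"
  shows "(\<lambda>N. len (N (i, j))) \<in> borel_measurable (network_space k)"
proof (rule borel_measurableI_le)
  fix a :: ennreal
  let ?X = "{N. \<exists>z. inj_on z {..<k} \<and> feasible {..<k} z N}"
  let ?G = "{{N\<in>?X. len (B \<inter> (\<Inter>p\<in>F. N p)) \<le> a} | B F a.
                 B \<in> sets borel \<and> F \<subseteq> pairs {..<k} \<and> F \<noteq> {}}"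
  have "{N \<in> ?X. len (N (i, j)) \<le> a} \<in> ?G"
    using assms by (auto intro!: exI[of _ UNIV] exI[of _ "{(i, j)}"] exI[of _ a] simp: pairs_def)
  moreover have "sets (network_space k) = sigma_sets ?X ?G"
    unfolding network_space_def Let_def by (rule sets_measure_of) auto
  ultimately show "{N \<in> space (network_space k). len (N (i, j)) \<le> a} \<in> sets (network_space k)"
    unfolding space_network_space by (metis (no_types, lifting) sigma_sets.Basic)
qed

text \<open>
  The set function defining \<^const>\<open>distr\<close> is replaced by 0 unless it is a measure. So if the outcome
  is not null, the formula for the image measure holds without assuming \<open>f\<close> measurable.
\<close>

lemma emeasure_distr_eq_prob:
  assumes eq: "distr M N f = P" and P: "emeasure P (space N) \<noteq> 0" and A: "A \<in> sets N"
  shows "emeasure P A = emeasure M (f -` A \<inter> space M)"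
proof -
  let ?\<mu> = "\<lambda>A. emeasure M (f -` A \<inter> space M)"
  have *: "emeasure P B = (if B \<in> sets N \<and> measure_space (space N) (sets N) ?\<mu> then ?\<mu> B else 0)" for B
    unfolding eq[symmetric] distr_def by (simp add: emeasure_measure_of_conv sets.space_closed sets.sigma_sets_eq)
  then show ?thesis using P A *[of "space N"] by (auto split: if_splits)
qed

text \<open>
  The maps \<open>f\<close> of interest are relabellings and similarities. It need not be checked that they
  preserve feasibility: as the image measure is a probability measure, \<open>f\<close> takes values in the
  space of networks almost surely. The predicate \<open>p\<close> describes an arbitrary event about the length.
\<close>

lemma len_law_pushforward:
  assumes eq: "distr M (network_space m) f = Q" and M: "prob_space M" and Q: "prob_space Q"
    and "i < m" "j < m" "i \<noteq> j"
    and meas: "(\<lambda>N. len (N (i', j'))) \<in> borel_measurable M"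
    and len_f: "\<And>N. N \<in> space M \<Longrightarrow> len (f N (i, j)) = c * len (N (i', j'))"
    and p[measurable]: "Measurable.pred borel p"
  shows "emeasure Q {N \<in> space Q. p (len (N (i, j)))} = emeasure M {N \<in> space M. p (c * len (N (i', j')))}"
proof -
  interpret M: prob_space M by fact
  interpret Q: prob_space Q by fact
  have spQ: "space Q = space (network_space m)" and seQ: "sets Q = sets (network_space m)" using eq by auto
  have P: "emeasure Q (space (network_space m)) = 1" using Q.emeasure_space_1 spQ by simp
  note push = emeasure_distr_eq_prob[OF eq]
  let ?S = "f -` space (network_space m) \<inter> space M"
  have S1: "emeasure M ?S = 1" using push[of "space (network_space m)"] P by simp
  then have S: "?S \<in> sets M" using emeasure_notin_sets[of ?S M] by fastforce
  then have AE: "AE N in M. N \<in> ?S" 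
    using S1 by (intro M.AE_in_set_eq_1[OF S, THEN iffD2]) (simp add: M.emeasure_eq_measure)
  let ?A = "{N \<in> space (network_space m). p (len (N (i, j)))}"
  have [measurable]: "(\<lambda>N. len (N (i, j))) \<in> borel_measurable (network_space m)"
    by (rule measurable_len_route[OF assms(4-6)])
  have A: "?A \<in> sets (network_space m)" by measurable
  let ?B = "{N \<in> space M. p (c * len (N (i', j')))}"
  note meas[measurable]
  have B: "?B \<in> sets M" by measurable
  have "emeasure Q ?A = emeasure M (f -` ?A \<inter> space M)"
    using push[OF _ A] P by simp
  also have "f -` ?A \<inter> space M = ?B \<inter> ?S" using len_f by auto
  also have "emeasure M (?B \<inter> ?S) = emeasure M ?B"
    using AE B S by (intro emeasure_eq_AE) auto
  finally show ?thesis unfolding spQ .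
qed


text \<open>The configuration of the two points \<open>0\<close> and \<open>1\<close>.\<close>

definition unit_pair :: "nat \<Rightarrow> complex" where
  "unit_pair = (\<lambda>i\<in>{..<2}. if i = 0 then 0 else 1)"

lemma space_configurations:
  "space (configurations k) = {z \<in> extensional {..<k}. inj_on z {..<k}}"
  by (auto simp: configurations_def space_restrict_space space_PiM PiE_def)

lemma lessThan_2: "{..<2::nat} = {0, 1}" by auto

lemma fdds_prob_space:
  assumes "measurable_fdds \<mu>" "z \<in> space (configurations k)"
  shows "prob_space (\<mu> k z)" "sets (\<mu> k z) = sets (network_space k)" "space (\<mu> k z) = space (network_space k)"
proof -
  have "\<mu> k z \<in> space (prob_algebra (network_space k))"
    using assms by (auto simp: measurable_fdds_def dest: measurable_space)
  then show "prob_space (\<mu> k z)" "sets (\<mu> k z) = sets (network_space k)"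
    by (auto simp: space_prob_algebra)
  then show "space (\<mu> k z) = space (network_space k)" by (rule_tac sets_eq_imp_space_eq)
qed

lemma len_law_invariant:
  fixes z :: "nat \<Rightarrow> complex"
  assumes inv: "invariant_under T \<mu>" and meas: "measurable_fdds \<mu>"
    and z: "z \<in> space (configurations 2)"
    and c: "c > 0" and T: "\<And>x y. dist (T x) (T y) = c * dist x y" and "surj T"
    and p: "Measurable.pred borel p"
  defines "z' \<equiv> (\<lambda>i\<in>{..<2}. T (z i))"
  shows "z' \<in> space (configurations 2)"
    and "emeasure (\<mu> 2 z') {N \<in> space (network_space 2). p (len (N (0, 1)))}
       = emeasure (\<mu> 2 z) {N \<in> space (network_space 2). p (ennreal c * len (N (0, 1)))}"
proof -
  have "inj T"
  proof (rule injI)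
    fix x y assume "T x = T y"
    then show "x = y" using T[of x y] c by auto
  qed
  then show z': "z' \<in> space (configurations 2)"
    using z by (auto simp: z'_def space_configurations inj_on_def)
  note Q = fdds_prob_space[OF meas z'] and M = fdds_prob_space[OF meas z]
  have "distr (\<mu> 2 z) (network_space 2) (\<lambda>N. \<lambda>p\<in>pairs {..<2}. T ` N p) = \<mu> 2 z'"
    using inv z unfolding invariant_under_def z'_def by blast
  from len_law_pushforward[OF this M(1) Q(1), where i=0 and j=1 and i'=0 and j'=1 and c="ennreal c", OF _ _ _ _ _ p]
  show "emeasure (\<mu> 2 z') {N \<in> space (network_space 2). p (len (N (0, 1)))}
       = emeasure (\<mu> 2 z) {N \<in> space (network_space 2). p (ennreal c * len (N (0, 1)))}"
    unfolding Q(3) M(3) measurable_cong_sets[OF M(2) refl]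
    using len_similarity[OF c T \<open>surj T\<close>] measurable_len_route[of 0 2 1] by (simp add: pairs_def)
qed

text \<open>
  The route between two points at distance \<open>d\<close> has the length of \<open>d\<close> times the route from 0 to 1,
  in law: scaling, rotating and translating \<open>(0, 1)\<close> yields \<open>(z i, z j)\<close>.
\<close>

lemma len_law_scaled:
  assumes \<mu>: "scale_invariant_fdds \<mu>" and z: "z \<in> space (configurations k)"
    and ij: "i < k" "j < k" "i \<noteq> j" and p[measurable]: "Measurable.pred borel p"
  shows "emeasure (\<mu> k z) {N \<in> space (network_space k). p (len (N (i, j)))}
       = emeasure (\<mu> 2 unit_pair) {N \<in> space (network_space 2). p (ennreal (dist (z i) (z j)) * len (N (0, 1)))}"
proof -
  have meas: "measurable_fdds \<mu>" and cons: "consistent \<mu>"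
    and tr: "\<And>b. invariant_under (\<lambda>x. b + x) \<mu>" and rot: "\<And>\<theta>. invariant_under (\<lambda>x. cis \<theta> * x) \<mu>"
    and sc: "\<And>c. c > 0 \<Longrightarrow> invariant_under (\<lambda>x. complex_of_real c * x) \<mu>"
    using \<mu> by (auto simp: scale_invariant_fdds_def)
  define v where "v = z j - z i"
  define d where "d = norm v"
  have "z i \<noteq> z j" using z ij by (auto simp: space_configurations inj_on_def)
  then have d: "d > 0" by (simp add: d_def v_def)
  define \<theta> where "\<theta> = Arg v"
  have v: "v = cis \<theta> * complex_of_real d"
    using rcis_cmod_Arg[of v] by (simp add: \<theta>_def d_def rcis_def mult.commute)
  have z0: "unit_pair \<in> space (configurations 2)"
    by (auto simp: space_configurations unit_pair_def inj_on_def lessThan_2)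
  define z1 where "z1 = (\<lambda>n\<in>{..<2}. complex_of_real d * unit_pair n)"
  define z2 where "z2 = (\<lambda>n\<in>{..<2}. cis \<theta> * z1 n)"
  define z3 where "z3 = (\<lambda>n\<in>{..<2}. z i + z2 n)"
  have surj1: "surj (\<lambda>x. complex_of_real d * x)"
    by (rule surjI[of _ "\<lambda>y. y / complex_of_real d"]) (use d in auto)
  have surj2: "surj (\<lambda>x. cis \<theta> * x)"
    by (rule surjI[of _ "\<lambda>y. y / cis \<theta>"]) auto
  have surj3: "surj (\<lambda>x. z i + x)" 
    by (rule surjI[of _ "\<lambda>y. y - z i"]) auto
  have dist1: "dist (complex_of_real d * x) (complex_of_real d * y) = d * dist x y" for x y
    using d by (simp add: dist_norm right_diff_distrib[symmetric] norm_mult)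
  have dist2: "dist (cis \<theta> * x) (cis \<theta> * y) = 1 * dist x y" for x y
    by (simp add: dist_norm right_diff_distrib[symmetric] norm_mult)
  have dist3: "dist (z i + x) (z i + y) = 1 * dist x y" for x y by simp
  have pd: "Measurable.pred borel (\<lambda>x. p (ennreal 1 * (ennreal 1 * x)))" "Measurable.pred borel (\<lambda>x. p (ennreal 1 * x))"
    by measurable
  note l1 = len_law_invariant[OF sc[OF d] meas z0 d dist1 surj1, folded z1_def]
  note z1 = l1(1)[OF p]
  note l2 = len_law_invariant[OF rot meas z1 zero_less_one dist2 surj2, folded z2_def]
  note z2 = l2(1)[OF p]
  note l3 = len_law_invariant[OF tr meas z2 zero_less_one dist3 surj3, folded z3_def]
  note z3 = l3(1)[OF p]
  have chain: "emeasure (\<mu> 2 z3) {N \<in> space (network_space 2). p (len (N (0, 1)))}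
     = emeasure (\<mu> 2 unit_pair) {N \<in> space (network_space 2). p (ennreal d * len (N (0, 1)))}"
    using l3(2)[OF p] l2(2)[OF pd(2)] l1(2)[OF pd(1)] by simp
  define f where "f = (\<lambda>n::nat. if n = 0 then i else j)"
  have f: "inj_on f {..<2} \<and> f ` {..<2} \<subseteq> {..<k}"
    using ij by (auto simp: f_def lessThan_2)
  have z3_eq: "(\<lambda>n\<in>{..<2}. z (f n)) = z3"
    by (auto simp: z3_def z2_def z1_def unit_pair_def f_def lessThan_2 fun_eq_iff v[symmetric] v_def)
  have eq: "distr (\<mu> k z) (network_space 2) (\<lambda>N. \<lambda>(i, j)\<in>pairs {..<2}. N (f i, f j)) = \<mu> 2 z3"
    using cons z f unfolding consistent_def z3_eq[symmetric] by blast
  note Q = fdds_prob_space[OF meas z3] and M = fdds_prob_space[OF meas z]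
  from len_law_pushforward[OF eq M(1) Q(1), where i=0 and j=1 and i'=i and j'=j and c=1, OF _ _ _ _ _ p]
  have "emeasure (\<mu> 2 z3) {N \<in> space (network_space 2). p (len (N (0, 1)))}
     = emeasure (\<mu> k z) {N \<in> space (network_space k). p (len (N (i, j)))}"
    unfolding Q(3) M(3) measurable_cong_sets[OF M(2) refl]
    using measurable_len_route[OF ij] by (simp add: pairs_def f_def)
  then show ?thesis using chain by (simp add: d_def v_def dist_norm norm_minus_commute)
qed

lemma len_excess_tail:
  assumes \<mu>: "scale_invariant_fdds \<mu>" and ED: "expected_D1 \<mu> = ennreal (1 + e)" and e: "e > 0"
    and z: "z \<in> space (configurations k)" and ij: "i < k" "j < k" "i \<noteq> j" and h: "h > 0"
  shows "emeasure (\<mu> k z) {N \<in> space (network_space k). ennreal (dist (z i) (z j) + h) < len (N (i, j))}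
     \<le> ennreal (e * dist (z i) (z j) / h)"
proof -
  have meas: "measurable_fdds \<mu>" and feas: "feasible_fdds \<mu>"
    using \<mu> by (auto simp: scale_invariant_fdds_def)
  define d where "d = dist (z i) (z j)"
  have "z i \<noteq> z j" using z ij by (auto simp: space_configurations inj_on_def)
  then have d: "d > 0" by (simp add: d_def)
  have z0: "unit_pair \<in> space (configurations 2)"
    by (auto simp: space_configurations unit_pair_def inj_on_def lessThan_2)
  let ?M = "\<mu> 2 unit_pair"
  note M = fdds_prob_space[OF meas z0]
  interpret M: prob_space ?M by (rule M(1))
  have L[measurable]: "(\<lambda>N. len (N (0, 1))) \<in> borel_measurable ?M"
    unfolding measurable_cong_sets[OF M(2) refl] by (rule measurable_len_route) auto
  then have [measurable]: "(\<lambda>N. len (N (0, Suc 0))) \<in> borel_measurable ?M" by simp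
  \<comment> \<open>A route is at least as long as the distance of its end points, so the excess is nonnegative.\<close>
  have AE1: "AE N in ?M. 1 \<le> len (N (0, 1))"
  proof -
    have "AE N in ?M. feasible {..<2} unit_pair N" using feas z0 by (auto simp: feasible_fdds_def)
    then show ?thesis
    proof eventually_elim
      case (elim N)
      then have "route (unit_pair 0) (unit_pair 1) (N (0, 1))"
        by (auto simp: feasible_def pairs_def)
      from dist_le_len_route[OF this] show ?case by (simp add: unit_pair_def)
    qed
  qed
  have "ennreal (1 + e) = (\<integral>\<^sup>+ N. len (N (0, 1)) \<partial>?M)"
    using ED by (simp add: expected_D1_def unit_pair_def)
  also have "\<dots> = (\<integral>\<^sup>+ N. 1 + (len (N (0, 1)) - 1) \<partial>?M)"
    using AE1 by (intro nn_integral_cong_AE) (auto elim!: eventually_mono simp: add_diff_inverse_ennreal)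
  also have "\<dots> = 1 + (\<integral>\<^sup>+ N. len (N (0, 1)) - 1 \<partial>?M)"
    by (subst nn_integral_add) (auto simp: M.emeasure_space_1)
  finally have Ee: "(\<integral>\<^sup>+ N. len (N (0, 1)) - 1 \<partial>?M) = ennreal e"
    using e by (simp add: ennreal_plus ennreal_add_left_cancel)
  have "emeasure (\<mu> k z) {N \<in> space (network_space k). ennreal (d + h) < len (N (i, j))}
     = emeasure ?M {N \<in> space ?M. ennreal (d + h) < ennreal d * len (N (0, 1))}"
    unfolding M(3) d_def by (rule len_law_scaled[OF \<mu> z ij]) measurable
  also have "\<dots> \<le> emeasure ?M {N \<in> space ?M. 1 \<le> ennreal (d / h) * (len (N (0, 1)) - 1)}"
  proof (intro emeasure_mono)
    show "{N \<in> space ?M. ennreal (d + h) < ennreal d * len (N (0, 1))}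
        \<subseteq> {N \<in> space ?M. 1 \<le> ennreal (d / h) * (len (N (0, 1)) - 1)}"
    proof (intro Collect_mono impI conjI; elim conjE)
      fix N assume *: "ennreal (d + h) < ennreal d * len (N (0, 1))"
      show "1 \<le> ennreal (d / h) * (len (N (0, 1)) - 1)"
      proof (cases "len (N (0, 1))")
        case (real x)
        with * d have "ennreal (d + h) < ennreal (d * x)" by (simp add: ennreal_mult del: ennreal_plus)
        then have "d + h < d * x" using d h by (simp add: ennreal_less_iff del: ennreal_plus)
        then have "1 \<le> d / h * (x - 1)" using h by (simp add: field_simps)
        then show ?thesis using real d h 
          by (simp add: ennreal_minus ennreal_1[symmetric] ennreal_mult'[symmetric] del: ennreal_1)
      next
        case top
        then show ?thesis using d h by (simp add: ennreal_mult_top)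
      qed
    qed
  qed measurable
  also have "\<dots> \<le> ennreal (d / h) * (\<integral>\<^sup>+ N. (len (N (0, 1)) - 1) * indicator (space ?M) N \<partial>?M)"
    by (rule nn_integral_Markov_inequality) measurable
  also have "(\<integral>\<^sup>+ N. (len (N (0, 1)) - 1) * indicator (space ?M) N \<partial>?M) = ennreal e"
    unfolding Ee[symmetric] by (intro nn_integral_cong) auto
  also have "ennreal (d / h) * ennreal e = ennreal (e * d / h)"
    using d h e by (simp add: ennreal_mult'[symmetric] mult.commute)
  finally show ?thesis unfolding d_def .
qed

section \<open>Short routes between sample points\<close>

text \<open>The space-time region whose points are the points of \<open>\<Xi>(1)\<close> in the unit disc around \<open>c\<close>.\<close>

definition cell :: "complex \<Rightarrow> (complex \<times> real) set" where
  "cell c = ball c 1 \<times> {0..1}"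

lemma cell_borel [measurable]: "cell c \<in> sets borel"
  unfolding cell_def borel_prod[symmetric] by measurable

lemma emeasure_cell: "emeasure lborel (cell c) = ennreal pi"
proof -
  have "emeasure (lborel :: (complex \<times> real) measure) (cell c)
     = emeasure (lborel \<Otimes>\<^sub>M lborel) (ball c 1 \<times> {0..1::real})"
    by (simp add: lborel_prod cell_def)
  also have "\<dots> = emeasure lborel (ball c 1) * emeasure lborel {0..1::real}"
    by (rule lborel.emeasure_pair_measure_Times) auto
  also have "\<dots> = ennreal pi" by (simp add: emeasure_ball unit_ball_vol_2)
  finally show ?thesis .
qed

lemma empty_cell_prob:
  assumes "rate_one_poisson M"
  shows "{\<omega> \<in> space M. \<forall>i. fst \<omega> i \<notin> cell c} \<in> sets M"
    and "measure M {\<omega> \<in> space M. \<forall>i. fst \<omega> i \<notin> cell c} = exp (- pi)"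
proof -
  have fin: "finite_volume (cell c)"
    by (auto simp: finite_volume_def emeasure_cell) (auto simp: cell_def)
  have vol: "measure lborel (cell c) = pi" by (simp add: measure_def emeasure_cell)
  have "{\<omega> \<in> space M. count_in (cell c) \<omega> = of_nat 0} = {\<omega> \<in> space M. \<forall>i. fst \<omega> i \<notin> cell c}"
    by (auto simp: count_in_def emeasure_count_space_eq_0)
  moreover have "measure M {\<omega> \<in> space M. count_in (cell c) \<omega> = of_nat 0} = pi ^ 0 / fact 0 * exp (- pi)"
    using assms fin unfolding rate_one_poisson_def vol[symmetric] by blast
  ultimately show "measure M {\<omega> \<in> space M. \<forall>i. fst \<omega> i \<notin> cell c} = exp (- pi)"
    by simp
  have "fst \<in> measurable M (PiM UNIV (\<lambda>_. borel))"
    using assms by (simp add: rate_one_poisson_def)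
  from measurable_compose[OF this measurable_component_singleton[OF UNIV_I]]
  have [measurable]: "(\<lambda>\<omega>. fst \<omega> i) \<in> measurable M borel" for i .
  show "{\<omega> \<in> space M. \<forall>i. fst \<omega> i \<notin> cell c} \<in> sets M" by measurable
qed

lemma sampled_AE_route:
  assumes "sampled \<mu> M"
  shows "AE \<omega> in M. \<forall>i j. i \<noteq> j \<longrightarrow> route (position \<omega> i) (position \<omega> j) (snd \<omega> (i, j))"
proof -
  have "AE \<omega> in M. \<forall>k. feasible {..<k} (position \<omega>) (restrict (snd \<omega>) (pairs {..<k}))"
    using assms by (simp add: sampled_def)
  then show ?thesis
  proof eventually_elim
    case (elim \<omega>)
    show ?case
    proof (intro allI impI)
      fix i j :: nat assume "i \<noteq> j"
      then have "(i, j) \<in> pairs {..<Suc (max i j)}" by (auto simp: pairs_def)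
      moreover have "feasible {..<Suc (max i j)} (position \<omega>) (restrict (snd \<omega>) (pairs {..<Suc (max i j)}))"
        using elim by blast
      ultimately show "route (position \<omega> i) (position \<omega> j) (snd \<omega> (i, j))"
        unfolding feasible_def by fastforce
    qed
  qed
qed

text \<open>
  Two distant unit discs contain sample points joined by a route whose length exceeds their
  distance by at most \<open>2 h\<close>, unless one of the discs is empty or the excess is more than \<open>h\<close>.

  The joint law of points and routes is given on product events only, while the threshold
  depends on the positions. Therefore the distance is discretised with mesh \<open>h\<close>: the event \<open>C (i, j, m)\<close>
  says that \<open>i\<close> and \<open>j\<close> are the first indices of points in the two cells and that the distance
  lies in \<open>[m h, (m + 1) h)\<close>, and the route is bad if its length exceeds \<open>(m + 2) h\<close>. These
  events are disjoint, so that their probabilities add up to at most 1.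
\<close>

lemma sampled_short_route_event:
  assumes \<mu>: "scale_invariant_fdds \<mu>" and ED: "expected_D1 \<mu> = ennreal (1 + e)" and e: "e > 0"
    and S: "sampled \<mu> M" and far: "dist p q > 2" and h: "h > 0"
  obtains G where "G \<in> sets M" "1 - 2 * exp (- pi) - e * (dist p q + 2) / h \<le> measure M G"
    "\<And>\<omega>. \<omega> \<in> G \<Longrightarrow> \<exists>i j. fst \<omega> i \<in> cell p \<and> fst \<omega> j \<in> cell q \<and> i \<noteq> j \<and>
        len (snd \<omega> (i, j)) \<le> ennreal (dist (position \<omega> i) (position \<omega> j) + 2 * h)"
proof -
  have rop: "rate_one_poisson M" using S by (simp add: sampled_def)
  interpret prob_space M using rop by (simp add: rate_one_poisson_def)
  have meas: "measurable_fdds \<mu>" using \<mu> by (simp add: scale_invariant_fdds_def)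
  have fstM[measurable]: "fst \<in> measurable M (PiM UNIV (\<lambda>_. borel))"
    using rop by (simp add: rate_one_poisson_def)
  have restM: "(\<lambda>\<omega>. restrict (snd \<omega>) (pairs {..<k})) \<in> measurable M (network_space k)" for k
    using S by (simp add: sampled_def)
  define c where "c = e * (dist p q + 2) / h"
  have disj: "u \<notin> cell q" if "u \<in> cell p" for u
    using that far dist_triangle[of p q "fst u"] by (auto simp: cell_def dist_commute)
  define C where "C = (\<lambda>(i, j, m). {y \<in> space (PiM UNIV (\<lambda>_. borel)) :: (nat \<Rightarrow> complex \<times> real) set.
      y i \<in> cell p \<and> (\<forall>i'<i. y i' \<notin> cell p) \<and> y j \<in> cell q \<and> (\<forall>j'<j. y j' \<notin> cell q) \<and>
      real m * h \<le> dist (fst (y i)) (fst (y j)) \<and> dist (fst (y i)) (fst (y j)) < (real m + 1) * h})"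
  have C: "C x \<in> sets (PiM UNIV (\<lambda>_. borel))" for x
  proof -
    have f[measurable]: "fst \<in> borel_measurable (borel :: (complex \<times> real) measure)"
      by (intro borel_measurable_continuous_onI continuous_intros)
    show ?thesis unfolding C_def by (cases x) (simp only: prod.case, measurable)
  qed
  have C_disj: "x = x'" if "y \<in> C x" "y \<in> C x'" for x x' y
  proof -
    obtain i j m where x: "x = (i, j, m)" by (cases x)
    obtain i' j' m' where x': "x' = (i', j', m')" by (cases x')
    have "i = i'" using that unfolding x x' C_def by (auto intro: linorder_cases[of i i'])
    moreover have "j = j'" using that unfolding x x' C_def by (auto intro: linorder_cases[of j j'])
    moreover have "m = m'"
    proof -
      let ?d = "dist (fst (y i)) (fst (y j))"
      have "real m * h \<le> ?d" "?d < (real m + 1) * h" "real m' * h \<le> ?d" "?d < (real m' + 1) * h"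
        using that \<open>i = i'\<close> \<open>j = j'\<close> unfolding x x' C_def by auto
      then have "real m * h < (real m' + 1) * h" "real m' * h < (real m + 1) * h" by linarith+
      then show ?thesis using h by simp
    qed
    ultimately show ?thesis by (simp add: x x')
  qed
  define K where "K = (\<lambda>(i, j, m :: nat). Suc (max i j))"
  define A where "A = (\<lambda>(i, j, m). {N \<in> space (network_space (K (i, j, m))). ennreal ((real m + 2) * h) < len (N (i, j))})"
  have A: "A x \<in> sets (network_space (K x))" if "y \<in> C x" for x y
  proof -
    obtain i j m where x: "x = (i, j, m)" by (cases x)
    have "y i \<in> cell p" "y j \<in> cell q" using that by (auto simp: x C_def)
    then have "i \<noteq> j" using disj[of "y i"] by metis
    then have [measurable]: "(\<lambda>N. len (N (i, j))) \<in> borel_measurable (network_space (K x))"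
      by (intro measurable_len_route) (auto simp: K_def x)
    show ?thesis unfolding A_def x prod.case unfolding x[symmetric] by measurable
  qed
  define R where "R k \<omega> = restrict (snd \<omega>) (pairs {..<k})" for k and \<omega> :: outcome
  define Bad where "Bad x = {\<omega> \<in> space M. fst \<omega> \<in> C x \<and> R (K x) \<omega> \<in> A x}" for x
  define Fst where "Fst x = {\<omega> \<in> space M. fst \<omega> \<in> C x}" for x
  have Fst: "Fst x \<in> sets M" for x
    unfolding Fst_def using measurable_sets[OF fstM C[of x]] by (simp add: vimage_def Int_def conj_commute)
  have Bad: "Bad x \<in> sets M" for x
  proof (cases "C x = {}")
    case False
    then have "A x \<in> sets (network_space (K x))" using A by blast
    from measurable_sets[OF restM this]
    have "Fst x \<inter> ((\<lambda>\<omega>. R (K x) \<omega>) -` A x \<inter> space M) \<in> sets M"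
      using Fst unfolding R_def by blast
    also have "Fst x \<inter> ((\<lambda>\<omega>. R (K x) \<omega>) -` A x \<inter> space M) = Bad x" by (auto simp: Fst_def Bad_def)
    finally show ?thesis .
  qed (simp add: Bad_def)
  \<comment> \<open>Conditionally on the points, the bad event is an excess of more than \<open>h\<close>.\<close>
  have bad_le: "emeasure M (Bad x) \<le> ennreal c * emeasure M (Fst x)" for x
  proof (cases "C x = {}")
    case False
    obtain i j m where x: "x = (i, j, m)" by (cases x)
    have Ax: "A x \<in> sets (network_space (K x))" using A False by blast
    let ?pos = "\<lambda>\<omega>. \<lambda>i\<in>{..<K x}. position \<omega> i"
    have "emeasure M (Bad x) = (\<integral>\<^sup>+ \<omega>. emeasure (\<mu> (K x) (?pos \<omega>)) (A x) * indicator (C x) (fst \<omega>) \<partial>M)"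
      using S C[of x] Ax unfolding sampled_def Bad_def R_def by blast
    also have "\<dots> \<le> (\<integral>\<^sup>+ \<omega>. ennreal c * indicator (C x) (fst \<omega>) \<partial>M)"
    proof (intro nn_integral_mono_AE, use sampled_AE_route[OF S] in eventually_elim)
      fix \<omega> assume r: "\<forall>i j. i \<noteq> j \<longrightarrow> route (position \<omega> i) (position \<omega> j) (snd \<omega> (i, j))"
      show "emeasure (\<mu> (K x) (?pos \<omega>)) (A x) * indicator (C x) (fst \<omega>) \<le> ennreal c * indicator (C x) (fst \<omega>)"
      proof (cases "fst \<omega> \<in> C x")
        case True
        then have ci: "fst \<omega> i \<in> cell p" and cj: "fst \<omega> j \<in> cell q"
          and dm: "dist (position \<omega> i) (position \<omega> j) < (real m + 1) * h"
          by (auto simp: C_def x position_def)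
        have "i \<noteq> j" using ci cj disj[of "fst \<omega> i"] by metis
        have ij: "i < K x" "j < K x" by (auto simp: K_def x)
        have z: "?pos \<omega> \<in> space (configurations (K x))"
          using r route_ends_distinct[of "position \<omega> _" "position \<omega> _"] unfolding space_configurations inj_on_def
          by auto metis
        note P = fdds_prob_space[OF meas z]
        have dpq: "dist (position \<omega> i) (position \<omega> j) \<le> dist p q + 2"
          using ci cj dist_triangle[of "position \<omega> i" "position \<omega> j" p] dist_triangle[of p "position \<omega> j" q]
          by (auto simp: cell_def position_def dist_commute mem_Times_iff)
        have "emeasure (\<mu> (K x) (?pos \<omega>)) (A x) \<le> emeasure (\<mu> (K x) (?pos \<omega>))
            {N \<in> space (network_space (K x)). ennreal (dist (?pos \<omega> i) (?pos \<omega> j) + h) < len (N (i, j))}"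
        proof (rule emeasure_mono)
          have [measurable]: "(\<lambda>N. len (N (i, j))) \<in> borel_measurable (network_space (K x))"
            by (intro measurable_len_route ij \<open>i \<noteq> j\<close>)
          have "{N \<in> space (network_space (K x)). ennreal (dist (?pos \<omega> i) (?pos \<omega> j) + h) < len (N (i, j))}
              \<in> sets (network_space (K x))" by measurable
          then show "{N \<in> space (network_space (K x)). ennreal (dist (?pos \<omega> i) (?pos \<omega> j) + h) < len (N (i, j))}
              \<in> sets (\<mu> (K x) (?pos \<omega>))" unfolding P(2) .
          have "ennreal (dist (?pos \<omega> i) (?pos \<omega> j) + h) \<le> ennreal ((real m + 2) * h)"
            using dm ij by (intro ennreal_leI) (simp add: algebra_simps)
          then show "A x \<subseteq> {N \<in> space (network_space (K x)). ennreal (dist (?pos \<omega> i) (?pos \<omega> j) + h) < len (N (i, j))}"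
            by (auto simp: A_def x intro: le_less_trans)
        qed
        also have "\<dots> \<le> ennreal (e * dist (?pos \<omega> i) (?pos \<omega> j) / h)"
          by (rule len_excess_tail[OF \<mu> ED e z ij \<open>i \<noteq> j\<close> h])
        also have "\<dots> \<le> ennreal c"
          unfolding c_def using e h dpq ij by (intro ennreal_leI divide_right_mono mult_left_mono) auto
        finally show ?thesis using True by simp
      qed simp
    qed
    also have "\<dots> = (\<integral>\<^sup>+ \<omega>. ennreal c * indicator (Fst x) \<omega> \<partial>M)"
      by (intro nn_integral_cong) (auto simp: Fst_def indicator_def)
    also have "\<dots> = ennreal c * emeasure M (Fst x)"
      using Fst by (simp add: nn_integral_cmult_indicator)
    finally show ?thesis .
  qed (simp add: Bad_def)
  have disjB: "disjoint_family Bad" and disjF: "disjoint_family Fst"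
    using C_disj by (fastforce simp: disjoint_family_on_def Bad_def Fst_def)+
  have UBad: "(\<Union>x. Bad x) \<in> sets M"
    using Bad by (intro sets.countable_UN'') auto
  have "emeasure M (\<Union>x. Bad x) = (\<integral>\<^sup>+ x. emeasure M (Bad x) \<partial>count_space UNIV)"
    using Bad disjB by (intro emeasure_UN_countable) auto
  also have "\<dots> \<le> (\<integral>\<^sup>+ x. ennreal c * emeasure M (Fst x) \<partial>count_space UNIV)"
    by (intro nn_integral_mono bad_le)
  also have "\<dots> = ennreal c * (\<integral>\<^sup>+ x. emeasure M (Fst x) \<partial>count_space UNIV)"
    by (rule nn_integral_cmult) simp
  also have "(\<integral>\<^sup>+ x. emeasure M (Fst x) \<partial>count_space UNIV) = emeasure M (\<Union>x. Fst x)"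
    using Fst disjF by (intro emeasure_UN_countable[symmetric]) auto
  also have "ennreal c * emeasure M (\<Union>x. Fst x) \<le> ennreal c * 1"
    by (intro mult_left_mono) (auto simp: emeasure_le_1)
  finally have pbad: "measure M (\<Union>x. Bad x) \<le> c"
    using e h by (simp add: emeasure_eq_measure c_def)
  define E where "E r = {\<omega> \<in> space M. \<forall>i. fst \<omega> i \<notin> cell r}" for r
  have E: "E r \<in> sets M" "measure M (E r) = exp (- pi)" for r
    unfolding E_def using empty_cell_prob[OF rop] by auto
  define G where "G = space M - (E p \<union> E q \<union> (\<Union>x. Bad x))"
  show thesis
  proof (rule that[of G])
    show "G \<in> sets M" unfolding G_def using E UBad by auto
    have "prob G = 1 - prob (E p \<union> E q \<union> (\<Union>x. Bad x))"
      unfolding G_def using E UBad by (intro prob_compl) auto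
    moreover have "prob (E p \<union> E q \<union> (\<Union>x. Bad x)) \<le> prob (E p) + prob (E q) + prob (\<Union>x. Bad x)"
      using measure_Un_le[of "E p \<union> E q" M "\<Union>x. Bad x"] measure_Un_le[of "E p" M "E q"] E(1) UBad
      by (simp add: sets.Un)
    ultimately show "1 - 2 * exp (- pi) - e * (dist p q + 2) / h \<le> prob G"
      using pbad E by (simp add: c_def)
    fix \<omega> assume \<omega>: "\<omega> \<in> G"
    then have sp: "\<omega> \<in> space M" by (simp add: G_def)
    define i where "i = (LEAST i. fst \<omega> i \<in> cell p)"
    define j where "j = (LEAST j. fst \<omega> j \<in> cell q)"
    have "\<exists>i. fst \<omega> i \<in> cell p" "\<exists>j. fst \<omega> j \<in> cell q" using \<omega> by (auto simp: G_def E_def)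
    then have ci: "fst \<omega> i \<in> cell p" and cj: "fst \<omega> j \<in> cell q"
      unfolding i_def j_def by (auto intro: LeastI_ex)
    have li: "fst \<omega> i' \<notin> cell p" if "i' < i" for i' using that not_less_Least unfolding i_def by blast
    have lj: "fst \<omega> j' \<notin> cell q" if "j' < j" for j' using that not_less_Least unfolding j_def by blast
    have "i \<noteq> j" using ci cj disj[of "fst \<omega> i"] by metis
    let ?d = "dist (position \<omega> i) (position \<omega> j)"
    define m where "m = nat \<lfloor>?d / h\<rfloor>"
    have "real m = of_int \<lfloor>?d / h\<rfloor>" using h by (simp add: m_def)
    then have "real m \<le> ?d / h" "?d / h < real m + 1" by linarith+
    then have m: "real m * h \<le> ?d" "?d < (real m + 1) * h" using h by (simp_all add: field_simps)
    define x where "x = (i, j, m)"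
    have "fst \<omega> \<in> C x" using ci cj li lj m by (simp add: C_def x_def position_def space_PiM)
    moreover have "\<omega> \<notin> Bad x" using \<omega> unfolding G_def by blast
    ultimately have "R (K x) \<omega> \<notin> A x" using sp by (auto simp: Bad_def)
    moreover have "R (K x) \<omega> \<in> space (network_space (K x))"
      using measurable_space[OF restM sp] by (simp add: R_def)
    ultimately have "len (R (K x) \<omega> (i, j)) \<le> ennreal ((real m + 2) * h)"
      by (auto simp: A_def x_def)
    also have "R (K x) \<omega> (i, j) = snd \<omega> (i, j)"
      using \<open>i \<noteq> j\<close> by (simp add: R_def K_def x_def pairs_def less_Suc_eq_le)
    also have "ennreal ((real m + 2) * h) \<le> ennreal (?d + 2 * h)"
      using m by (intro ennreal_leI) (simp add: algebra_simps)
    finally show "\<exists>i j. fst \<omega> i \<in> cell p \<and> fst \<omega> j \<in> cell q \<and> i \<noteq> j \<and>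
        len (snd \<omega> (i, j)) \<le> ennreal (dist (position \<omega> i) (position \<omega> j) + 2 * h)"
      using ci cj \<open>i \<noteq> j\<close> by blast
  qed
qed

section \<open>The lower bound for the edge-intensity\<close>

text \<open>
  The expected length of the network inside the disc of radius \<open>1000 n\<close> is at least \<open>25 n\<^sup>3\<close>, and
  \<open>\<pi> (1000 n)\<^sup>2\<close> times the edge-intensity.
\<close>

lemma ell_ge_scale:
  fixes n :: nat
  assumes \<mu>: "scale_invariant_fdds \<mu>" and ED: "expected_D1 \<mu> = ennreal (1 + e)" and e: "e > 0"
    and ell: "has_ell \<mu> l" and n: "n \<ge> 1" and en: "e * (real n)\<^sup>2 \<le> 1 / 10^6"
  shows "ennreal (real n / 160000) \<le> l"
proof -
  obtain M where S: "sampled \<mu> M" and I: "has_edge_intensity M (S_edges 1) l"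
    using ell by (auto simp: has_ell_def)
  have n1: "real n \<ge> 1" using n by simp
  define p where "p x = Complex 0 (200 * real (fst x))" for x :: "nat \<times> nat"
  define q where "q x = Complex (200 * real n) (200 * real (snd x))" for x :: "nat \<times> nat"
  let ?X = "{..<n} \<times> {..<n}"
  let ?h = "1 / (200 * real n)"
  interpret prob_space M using S by (simp add: sampled_def rate_one_poisson_def)
  have "\<exists>G. G \<in> sets M \<and> 1 / 4 \<le> measure M G \<and>
      (\<forall>\<omega>\<in>G. \<exists>i j. fst \<omega> i \<in> cell (p x) \<and> fst \<omega> j \<in> cell (q x) \<and> i \<noteq> j \<and>
        len (snd \<omega> (i, j)) \<le> ennreal (dist (position \<omega> i) (position \<omega> j) + 1 / (100 * real n)))"
    if x: "x \<in> ?X" for x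
  proof -
    have D: "Re (p x - q x) = - 200 * real n" "Im (p x - q x) = 200 * (real (fst x) - real (snd x))"
      by (simp_all add: p_def q_def)
    have "200 * real n \<le> dist (p x) (q x)"
      using abs_Re_le_cmod[of "p x - q x"] unfolding D by (simp add: dist_norm)
    then have far: "2 < dist (p x) (q x)" using n1 by linarith
    have "\<bar>Im (p x - q x)\<bar> \<le> 200 * real n" using x unfolding D by (auto simp: abs_mult abs_le_iff)
    moreover have "\<bar>Re (p x - q x)\<bar> = 200 * real n" unfolding D by simp
    ultimately have "dist (p x) (q x) \<le> 400 * real n"
      using cmod_le[of "p x - q x"] unfolding dist_norm by linarith
    then have near: "dist (p x) (q x) + 2 \<le> 402 * real n" using n1 by linarith
    have "e * (dist (p x) (q x) + 2) / ?h \<le> e * (402 * real n) / ?h"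
      using e near by (intro divide_right_mono mult_left_mono) auto
    also have "\<dots> = 80400 * (e * (real n)\<^sup>2)" by (simp add: power2_eq_square)
    also have "\<dots> \<le> 80400 * (1 / 10^6)" by (intro mult_left_mono en) auto
    also have "\<dots> \<le> 1 / 4" by simp
    finally have pr: "e * (dist (p x) (q x) + 2) / ?h \<le> 1 / 4" .
    have "exp pi \<ge> 4" using exp_ge_add_one_self[of pi] pi_gt3 by linarith
    then have "exp (- pi) \<le> 1 / 4" by (simp add: exp_minus field_simps)
    then have p4: "1 / 4 \<le> 1 - 2 * exp (- pi) - e * (dist (p x) (q x) + 2) / ?h" using pr by linarith
    have h: "?h > 0" and h2: "2 * ?h = 1 / (100 * real n)" using n1 by simp_all
    show ?thesis
    proof (rule sampled_short_route_event[OF \<mu> ED e S far h, unfolded h2])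
      fix G assume "G \<in> sets M" "1 - 2 * exp (- pi) - e * (dist (p x) (q x) + 2) / ?h \<le> measure M G"
        "\<And>\<omega>. \<omega> \<in> G \<Longrightarrow> \<exists>i j. fst \<omega> i \<in> cell (p x) \<and> fst \<omega> j \<in> cell (q x) \<and> i \<noteq> j \<and>
          len (snd \<omega> (i, j)) \<le> ennreal (dist (position \<omega> i) (position \<omega> j) + 1 / (100 * real n))"
      with p4 show ?thesis by (intro exI[of _ G] conjI ballI) (assumption | linarith | blast)+
    qed
  qed
  then obtain G where G: "\<And>x. x \<in> ?X \<Longrightarrow> G x \<in> sets M" "\<And>x. x \<in> ?X \<Longrightarrow> 1 / 4 \<le> measure M (G x)"
    "\<And>x \<omega>. x \<in> ?X \<Longrightarrow> \<omega> \<in> G x \<Longrightarrow> \<exists>i j. fst \<omega> i \<in> cell (p x) \<and> fst \<omega> j \<in> cell (q x) \<and> i \<noteq> j \<and>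
        len (snd \<omega> (i, j)) \<le> ennreal (dist (position \<omega> i) (position \<omega> j) + 1 / (100 * real n))"
    by metis
  let ?B = "ball 0 (1000 * real n) :: complex set"
  have pointwise: "(\<Sum>x\<in>?X. ennreal (100 * real n) * indicator (G x) \<omega>) \<le> len (S_edges 1 \<omega> \<inter> ?B)"
    if r: "\<forall>i j. i \<noteq> j \<longrightarrow> route (position \<omega> i) (position \<omega> j) (snd \<omega> (i, j))" for \<omega>
  proof -
    define J where "J = {x \<in> ?X. \<omega> \<in> G x}"
    have "\<forall>x\<in>J. \<exists>i j. fst \<omega> i \<in> cell (p x) \<and> fst \<omega> j \<in> cell (q x) \<and> i \<noteq> j \<and>
        len (snd \<omega> (i, j)) \<le> ennreal (dist (position \<omega> i) (position \<omega> j) + 1 / (100 * real n))"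
      using G(3) by (auto simp: J_def)
    then obtain i j where ij: "\<And>x. x \<in> J \<Longrightarrow> fst \<omega> (i x) \<in> cell (p x)" "\<And>x. x \<in> J \<Longrightarrow> fst \<omega> (j x) \<in> cell (q x)"
      "\<And>x. x \<in> J \<Longrightarrow> i x \<noteq> j x"
      "\<And>x. x \<in> J \<Longrightarrow> len (snd \<omega> (i x, j x)) \<le> ennreal (dist (position \<omega> (i x)) (position \<omega> (j x)) + 1 / (100 * real n))"
      by metis
    have "(\<Sum>x\<in>?X. ennreal (100 * real n) * indicator (G x) \<omega>) = (\<Sum>x\<in>J. ennreal (100 * real n))"
      by (rule sum.mono_neutral_cong_right) (auto simp: J_def)
    also have "\<dots> = ennreal (real (card J) * (100 * real n))"
      by (simp add: ennreal_mult ennreal_of_nat_eq_real_of_nat)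
    also have "\<dots> \<le> len (S_edges 1 \<omega> \<inter> ?B)"
    proof (rule tight_routes_len[OF n])
      show "J \<subseteq> ?X" by (auto simp: J_def)
      show "dist (position \<omega> (i (b, c))) (Complex 0 (200 * real b)) \<le> 1" if "(b, c) \<in> J" for b c
        using ij(1)[OF that] by (auto simp: cell_def p_def position_def dist_commute mem_Times_iff)
      show "dist (position \<omega> (j (b, c))) (Complex (200 * real n) (200 * real c)) \<le> 1" if "(b, c) \<in> J" for b c
        using ij(2)[OF that] by (auto simp: cell_def q_def position_def dist_commute mem_Times_iff)
      show "route (position \<omega> (i x)) (position \<omega> (j x)) (snd \<omega> (i x, j x))" if "x \<in> J" for x
        using r ij(3)[OF that] by blast
      show "len (snd \<omega> (i x, j x)) \<le> ennreal (dist (position \<omega> (i x)) (position \<omega> (j x)) + 1 / (100 * real n))"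
        if "x \<in> J" for x using ij(4)[OF that] .
      show "snd \<omega> (i x, j x) \<subseteq> S_edges 1 \<omega>" if "x \<in> J" for x
      proof -
        have "(i x, j x) \<in> pairs (arrived 1 \<omega>)"
          using ij(1-3)[OF that] by (auto simp: pairs_def arrived_def arrival_def cell_def mem_Times_iff)
        then show ?thesis unfolding S_edges_def by blast
      qed
    qed
    finally show ?thesis .
  qed
  \<comment> \<open>each of the \<open>n\<^sup>2\<close> pairs contributes \<open>100 n\<close> with probability at least \<open>1 / 4\<close>\<close>
  have "ennreal (25 * real n ^ 3) = (\<Sum>x\<in>?X. ennreal (100 * real n) * ennreal (1 / 4))"
    by (simp add: ennreal_mult'[symmetric] ennreal_of_nat_eq_real_of_nat power3_eq_cube algebra_simps
             flip: of_nat_mult)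
  also have "\<dots> \<le> (\<Sum>x\<in>?X. ennreal (100 * real n) * emeasure M (G x))"
    using G(2) by (intro sum_mono mult_left_mono) (auto simp: emeasure_eq_measure intro!: ennreal_leI)
  also have "\<dots> = (\<Sum>x\<in>?X. \<integral>\<^sup>+ \<omega>. ennreal (100 * real n) * indicator (G x) \<omega> \<partial>M)"
    using G(1) by (intro sum.cong refl) (simp add: nn_integral_cmult_indicator)
  also have "\<dots> = (\<integral>\<^sup>+ \<omega>. (\<Sum>x\<in>?X. ennreal (100 * real n) * indicator (G x) \<omega>) \<partial>M)"
    using G(1) by (intro nn_integral_sum[symmetric]) auto
  also have "\<dots> \<le> (\<integral>\<^sup>+ \<omega>. len (S_edges 1 \<omega> \<inter> ?B) \<partial>M)"
    by (intro nn_integral_mono_AE, use sampled_AE_route[OF S] in eventually_elim) (rule pointwise)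
  also have "\<dots> = l * emeasure lborel ?B"
    using I by (simp add: has_edge_intensity_def)
  also have "\<dots> = l * ennreal (pi * (1000 * real n)\<^sup>2)"
    by (simp add: emeasure_ball unit_ball_vol_2)
  also have "\<dots> \<le> l * ennreal (4 * (1000 * real n)\<^sup>2)"
    using pi_less_4 by (intro mult_left_mono ennreal_leI mult_right_mono) auto
  finally have main: "ennreal (25 * real n ^ 3) \<le> l * ennreal (4 * (1000 * real n)\<^sup>2)" .
  show ?thesis
  proof (cases l)
    case (real x)
    then have "25 * real n ^ 3 \<le> x * (4 * (1000 * real n)\<^sup>2)"
      using main by (simp add: ennreal_mult'[symmetric])
    then have "(real n)\<^sup>2 * (25 * real n) \<le> (real n)\<^sup>2 * (4000000 * x)"
      by (simp add: power2_eq_square power3_eq_cube algebra_simps)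
    then have "25 * real n \<le> 4000000 * x" using n1 by simp
    then show ?thesis using real by (simp add: ennreal_leI)
  qed simp
qed

theorem proposition16:
  shows "\<exists>c>0. \<exists>\<delta>>0. \<forall>\<Delta>::real. 1 < \<Delta> \<and> \<Delta> < 1 + \<delta> \<longrightarrow>
    ennreal (c * (\<Delta> - 1) powr (- 1 / 2)) \<le> ell_star \<Delta>"
proof (rule exI[of _ "1 / (320000 * 1000)"], rule conjI, simp,
       rule exI[of _ "1 / 10^6"], rule conjI, simp, intro allI impI)
  fix \<Delta> :: real assume \<Delta>: "1 < \<Delta> \<and> \<Delta> < 1 + 1 / 10^6"
  define e where "e = \<Delta> - 1"
  have e: "0 < e" "e < 1 / 10^6" using \<Delta> by (auto simp: e_def)
  \<comment> \<open>\<open>n\<close> is the integer part of the largest \<open>t\<close> with \<open>e t\<^sup>2 \<le> 1 / 10^6\<close>, and is at least \<open>t / 2\<close>.\<close>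
  define t where "t = 1 / (1000 * sqrt e)"
  have "sqrt e < 1 / 1000" using e by (intro real_less_lsqrt) (auto simp: power2_eq_square)
  then have t: "t > 1" using e by (simp add: t_def field_simps)
  have et: "e * t\<^sup>2 = 1 / 10^6" using e by (simp add: t_def power_divide power_mult_distrib)
  define n where "n = nat \<lfloor>t\<rfloor>"
  have n: "real n \<le> t" "t < real n + 1" using t by (auto simp: n_def)
  then have n1: "n \<ge> 1" using t by linarith
  then have half: "t / 2 \<le> real n" using n by linarith
  have "e * (real n)\<^sup>2 \<le> e * t\<^sup>2" using e n by (intro mult_left_mono power_mono) auto
  then have en: "e * (real n)\<^sup>2 \<le> 1 / 10^6" using et by simp
  have "(\<Delta> - 1) powr (- 1 / 2) = 1 / sqrt e"
    using e by (simp add: e_def[symmetric] powr_minus powr_half_sqrt inverse_eq_divide)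
  then have c: "1 / (320000 * 1000) * (\<Delta> - 1) powr (- 1 / 2) = (t / 2) / 160000"
    by (simp add: t_def)
  show "ennreal (1 / (320000 * 1000) * (\<Delta> - 1) powr (- 1 / 2)) \<le> ell_star \<Delta>"
    unfolding ell_star_def
  proof (rule Inf_greatest, clarify)
    fix l \<mu> assume \<mu>: "sirsn \<mu>" "expected_D1 \<mu> = ennreal \<Delta>" "has_ell \<mu> l"
    have "ennreal (1 / (320000 * 1000) * (\<Delta> - 1) powr (- 1 / 2)) \<le> ennreal (real n / 160000)"
      unfolding c using half by (intro ennreal_leI) simp
    also have "\<dots> \<le> l"
      by (rule ell_ge_scale[of \<mu> e]) (use \<mu> e en n1 in \<open>auto simp: sirsn_def e_def\<close>)
    finally show "ennreal (1 / (320000 * 1000) * (\<Delta> - 1) powr (- 1 / 2)) \<le> l" .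
  qed
qed

end
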